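(* (Prime Number Theorem) For real $x>0$ let $\Pi(x)=\sum_{p<x}1$, the sum being over primes $p$, be the number of primes less than $x$. Then $$\lim_{x\to\infty}\frac{\Pi(x)}{x/\log x}=1 .$$
   Context: $\log$ denotes the natural logarithm. *)

theory Defs
  imports Complex_Main "HOL-Computational_Algebra.Primes"
begin

(* Strict inequality: a prime x is not counted in prime_count x. *)
definition prime_count :: "real \<Rightarrow> nat" where
  "prime_count x = (\<Sum>p | prime (p::nat) \<and> real p < x. 1)"

end

(* Newman's proof. With Z(s) = (s - 1) zeta(s), which is holomorphic for Re s > 0, the series
   sum Lambda(n) n^(-s) equals 1/(s - 1) - Z'(s)/Z(s). The inequality 3 + 4 cos y + cos 2y >= 0 shows that Z has no
   zero on Re s = 1, so the Dirichlet series with the coefficients (psi(n) - n)/n, which are bounded by Chebyshev's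
   estimate, continues holomorphically to a neighbourhood of Re s >= 1. Newman's Tauberian theorem then gives the
   convergence of sum (psi(n) - n)/n^2, which forces psi(n) ~ n because psi is monotone. *)
theory Submission
  imports
    Defs
    "HOL-Complex_Analysis.Complex_Analysis"
    "HOL-Number_Theory.Prime_Powers"
begin

section \<open>Newman's Tauberian theorem\<close>

text \<open>The Tauberian theorem asks for bounded coefficients. Those of
  \<open>mangoldt_series - zeta\<close> grow like log n along the primes, which is why the argument
  passes to the summatory function \<open>psi n - n\<close> and divides by n. Partial summation,
  however, produces n^(-s) - (n+1)^(-s) instead of s n^(-1-s), and the gap between the two has to be
  continued past Re s = 1 as well. It is \<open>powr_remainder n (s + 1)\<close>, of size n^(-2 - Re
  s), so against coefficients of linear growth it still converges for Re s > 0. The same remainder,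
  taken at s, continues (s - 1) zeta(s), so a single Taylor estimate serves both purposes. In
  Newman's theorem the radius R stays fixed while N grows. Only a compact piece of the imaginary
  axis enters, so holomorphy near the axis is enough, and the surviving error 2 C / R is removed by
  choosing R large at the end.\<close>

lemma powr_diff_mvt:
  fixes a x :: real
  assumes "x > 0"
  obtains y where "x < y" "y < x + 1" "(x + 1) powr a - x powr a = a * y powr (a - 1)"
proof -
  have "\<exists>y. x < y \<and> y < x + 1 \<and> (x + 1) powr a - x powr a = (x + 1 - x) * (a * y powr (a - 1))"
    by (rule MVT2) (use assms in \<open>auto intro!: derivative_eq_intros simp: powr_diff\<close>)
  then show ?thesis
    using that by auto
qed

text \<open>Comparison with the integral of x^(s-1) over [0, N+1], done by the mean value theorem.
  For s <= 1 the summand decreases and the integral alone suffices; for s > 1 it increases, the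
  integral dominates all terms but the last, and the last one is added.\<close>

lemma sum_powr_le:
  fixes s :: real
  assumes s: "s > 0"
  shows "(\<Sum>n=1..Suc N. real n powr (s - 1)) \<le> real (Suc N) powr (s - 1) + real (Suc N) powr s / s"
proof (cases "s \<le> 1")
  case True
  have "(\<Sum>n=1..Suc N. real n powr (s - 1)) \<le> real (Suc N) powr s / s"
  proof (induction N)
    case (Suc N)
    obtain y where y: "real (Suc N) < y" "y < real (Suc N) + 1"
        "(real (Suc N) + 1) powr s - real (Suc N) powr s = s * y powr (s - 1)"
      using powr_diff_mvt[of "real (Suc N)" s] by auto
    have "(real (Suc N) + 1) powr (s - 1) \<le> y powr (s - 1)"
      using y True by (intro powr_mono2') auto
    also have "\<dots> = ((real (Suc N) + 1) powr s - real (Suc N) powr s) / s"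
      using y(3) s by simp
    finally show ?case
      using Suc by (simp add: diff_divide_distrib add_ac)
  qed (use s True in auto)
  then show ?thesis
    by (smt (verit) powr_ge_zero)
next
  case False
  show ?thesis
  proof (induction N)
    case (Suc N)
    obtain y where y: "real (Suc N) < y" "y < real (Suc N) + 1"
        "(real (Suc N) + 1) powr s - real (Suc N) powr s = s * y powr (s - 1)"
      using powr_diff_mvt[of "real (Suc N)" s] by auto
    have "(real (Suc N)) powr (s - 1) \<le> y powr (s - 1)"
      using y False by (intro powr_mono2) auto
    also have "\<dots> = ((real (Suc N) + 1) powr s - real (Suc N) powr s) / s"
      using y(3) s by simp
    finally show ?case
      using Suc by (simp add: diff_divide_distrib add_ac)
  qed (use s in auto)
qed

lemma sums_powr_tail_le:
  fixes s :: real
  assumes s: "s > 0" and N: "N > 0"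
  shows "summable (\<lambda>n. real (n + Suc N) powr (- 1 - s))"
    and "(\<Sum>n. real (n + Suc N) powr (- 1 - s)) \<le> real N powr (- s) / s"
proof -
  let ?t = "\<lambda>n. real (n + N) powr (- s)"
  have lim: "?t \<longlonglongrightarrow> 0"
    by (intro tendsto_neg_powr filterlim_compose[OF filterlim_real_sequentially]
          filterlim_add_const_nat_at_top) (use s in auto)
  have tele: "(\<lambda>n. ?t n / s - ?t (Suc n) / s) sums (?t 0 / s - 0 / s)"
    by (intro telescope_sums' tendsto_intros lim) (use s in auto)
  have le: "real (n + Suc N) powr (- 1 - s) \<le> ?t n / s - ?t (Suc n) / s" for n
  proof -
    obtain y where y: "real (n + N) < y" "y < real (n + N) + 1"
        "(real (n + N) + 1) powr (- s) - real (n + N) powr (- s) = - s * y powr (- s - 1)"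
      using powr_diff_mvt[of "real (n + N)" "-s"] N by auto
    have "real (n + Suc N) powr (- 1 - s) \<le> y powr (- s - 1)"
      using y s N minus_diff_commute[of s 1] by (subst minus_diff_commute, intro powr_mono2') auto
    also have "\<dots> = ?t n / s - ?t (Suc n) / s"
      using y(3) s by (simp add: field_simps)
    finally show ?thesis .
  qed
  show sm: "summable (\<lambda>n. real (n + Suc N) powr (- 1 - s))"
    by (rule summable_comparison_test'[OF sums_summable[OF tele], of 0]) (use le in auto)
  have "(\<Sum>n. real (n + Suc N) powr (- 1 - s)) \<le> (\<Sum>n. ?t n / s - ?t (Suc n) / s)"
    by (intro suminf_le le sm sums_summable[OF tele])
  then show "(\<Sum>n. real (n + Suc N) powr (- 1 - s)) \<le> real N powr (- s) / s"
    using sums_unique[OF tele] by simp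
qed

lemma summable_powr_real:
  fixes s :: real
  assumes "s > 0"
  shows "summable (\<lambda>n. real n powr (- 1 - s))"
  using sums_powr_tail_le(1)[OF assms, of 1] summable_iff_shift[of "\<lambda>n. real n powr (- 1 - s)" 2]
  by simp

section \<open>Dirichlet sums with bounded coefficients in the two half-planes\<close>

lemma norm_of_nat_powr: "norm (of_nat n powr z :: complex) = real n powr Re z"
  by (subst norm_powr_real_powr) auto

text \<open>Estimate for the left half circle. The factor \<open>1 / s\<close> is later cancelled by
  Newman's kernel and \<open>real (Suc N) powr s\<close> by the factor N^z of the integrand.\<close>

lemma norm_partial_dirichlet_le:
  fixes a :: "nat \<Rightarrow> complex"
  assumes a: "\<And>n. norm (a n) \<le> C" and s: "s > 0" "Re z = - s"
  shows "norm (\<Sum>n\<le>Suc N. a n * of_nat n powr (- 1 - z))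
         \<le> C * (real (Suc N) powr (s - 1) + real (Suc N) powr s / s)"
proof -
  have C: "C \<ge> 0"
    using a[of 0] norm_ge_zero order_trans by blast
  have "norm (\<Sum>n\<le>Suc N. a n * of_nat n powr (- 1 - z)) \<le> (\<Sum>n\<le>Suc N. C * real n powr (s - 1))"
    by (intro sum_norm_le) (use s in \<open>simp add: norm_mult norm_of_nat_powr mult_right_mono a\<close>)
  \<comment> \<open>The term n = 0 drops out because \<open>0 powr z = 0\<close>.\<close>
  also have "\<dots> = (\<Sum>n=1..Suc N. C * real n powr (s - 1))"
    by (intro sum.mono_neutral_right) (auto simp: not_le)
  also have "\<dots> = C * (\<Sum>n=1..Suc N. real n powr (s - 1))"
    by (rule sum_distrib_left [symmetric])
  also have "\<dots> \<le> C * (real (Suc N) powr (s - 1) + real (Suc N) powr s / s)"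
    by (intro mult_left_mono sum_powr_le s C)
  finally show ?thesis .
qed

text \<open>The counterpart for the right half circle: here the tail is small, and again the kernel
  cancels \<open>1 / Re z\<close>.\<close>

lemma norm_tail_dirichlet_le:
  fixes a :: "nat \<Rightarrow> complex"
  assumes a: "\<And>n. norm (a n) \<le> C" and s: "Re z > 0"
    and F: "(\<lambda>n. a n * of_nat n powr (- 1 - z)) sums F"
  shows "norm (F - (\<Sum>n\<le>Suc N. a n * of_nat n powr (- 1 - z)))
         \<le> C * (real (Suc N) powr (- Re z) / Re z)"
proof -
  have C: "C \<ge> 0"
    using a[of 0] norm_ge_zero order_trans by blast
  let ?f = "\<lambda>n. a n * of_nat n powr (- 1 - z)"
  let ?g = "\<lambda>n. C * real (n + Suc (Suc N)) powr (- 1 - Re z)"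
  have g: "summable ?g"
    by (intro summable_mult sums_powr_tail_le s) auto
  have fg: "norm (?f (n + Suc (Suc N))) \<le> ?g n" for n
    by (simp only: norm_mult norm_of_nat_powr) (use a in \<open>auto intro!: mult_right_mono\<close>)
  have "(\<lambda>n. ?f (n + Suc (Suc N))) sums (F - sum ?f {..<Suc (Suc N)})"
    using F by (rule sums_split_initial_segment)
  then have "F - (\<Sum>n\<le>Suc N. ?f n) = (\<Sum>n. ?f (n + Suc (Suc N)))"
    by (simp add: sums_iff lessThan_Suc_atMost)
  also have "norm \<dots> \<le> (\<Sum>n. ?g n)"
    by (rule norm_suminf_le[OF fg g])
  also have "\<dots> = C * (\<Sum>n. real (n + Suc (Suc N)) powr (- 1 - Re z))"
    by (intro suminf_mult sums_powr_tail_le s) auto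
  also have "\<dots> \<le> C * (real (Suc N) powr (- Re z) / Re z)"
    by (intro mult_left_mono sums_powr_tail_le s C) auto
  finally show ?thesis .
qed


text \<open>On \<open>|z| = R\<close> one has \<open>1 / z = cnj z / R\<^sup>2\<close>, so Newman's kernel \<open>1 / z + z / R\<^sup>2\<close> is real there and
  vanishes at the endpoints \<open>\<plusminus>\<i> R\<close> of the two half circles.\<close>
lemma newman_kernel:
  assumes "norm z = R" "R > 0"
  shows "(1 + z\<^sup>2 / of_real R ^ 2) / z = of_real (2 * Re z / R\<^sup>2)"
proof -
  have z: "z \<noteq> 0" using assms by auto
  have R: "of_real R ^ 2 = z * cnj z"
    using complex_norm_square[of z] assms by simp
  have "(1 + z\<^sup>2 / (z * cnj z)) / z = (cnj z + z) / (z * cnj z)"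
    using z by (simp add: field_simps power2_eq_square)
  also have "cnj z + z = of_real (2 * Re z)"
    by (simp add: complex_eq_iff)
  finally show ?thesis
    unfolding R[symmetric] by simp
qed

text \<open>Since \<open>F 0 = 0\<close>, the function \<open>F z / z\<close> is holomorphic, so the contour integrals below can be evaluated
  with primitives on convex sets and no winding numbers are needed. The entire function \<open>S N\<close> is integrated
  over both half circles, \<open>F\<close> over the right one only; the latter integral is moved to three sides of a
  rectangle in the left half-plane, where the factor \<open>N powr z\<close> makes it small.\<close>
lemma newman_core:
  fixes a :: "nat \<Rightarrow> complex" and F :: "complex \<Rightarrow> complex"
  assumes a: "\<And>n. norm (a n) \<le> C"
    and U: "open U" "{z. Re z \<ge> 0} \<subseteq> U" and holF: "F holomorphic_on U"
    and F: "\<And>z. Re z > 0 \<Longrightarrow> (\<lambda>n. a n * of_nat n powr (- 1 - z)) sums F z"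
    and F0: "F 0 = 0" and R: "R > 0" and e: "e > 0"
  shows "\<forall>\<^sub>F N in sequentially. norm (\<Sum>n\<le>Suc N. a n * of_nat n powr (- 1)) \<le> 2 * C / R + e"
proof -
  have C: "C \<ge> 0"
    using a[of 0] norm_ge_zero order_trans by blast
  define G where "G = (\<lambda>z. if z = 0 then deriv F 0 else (F z - F 0) / (z - 0))"
  define H where "H = (\<lambda>z. G z * (1 + z\<^sup>2 / of_real R ^ 2))"
  have holG: "G holomorphic_on U"
    unfolding G_def using holF U(1) by (rule pole_lemma_open)
  have holH: "H holomorphic_on U"
    unfolding H_def by (intro holomorphic_intros holG) (use R in auto)
  \<comment> \<open>Compactness of \<open>K\<close> gives one width \<open>d1\<close> by which
    \<open>U\<close> reaches into the left half-plane. The margin R + 1 leaves room for an open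
    convex \<open>V\<close> inside \<open>U\<close> that contains both the closed right half circle
    and the rectangle of the detour.\<close>
  define K where "K = {z. Re z = 0 \<and> \<bar>Im z\<bar> \<le> R + 1}"
  have "K = cbox (Complex 0 (- (R + 1))) (Complex 0 (R + 1))"
    by (auto simp: K_def in_cbox_complex_iff)
  then have "compact K"
    by simp
  moreover have "K \<subseteq> U"
    using U(2) by (auto simp: K_def)
  ultimately obtain d1 where d1: "d1 > 0" "(\<Union>z\<in>K. ball z d1) \<subseteq> U"
    using compact_subset_open_imp_ball_epsilon_subset U(1) by metis
  define V where "V = {z. Re z > - d1} \<inter> {z. Im z > - (R + 1)} \<inter> {z. Im z < R + 1}"
  have V: "open V" "convex V"
    unfolding V_def
    by (intro open_Int open_halfspace_Re_gt open_halfspace_Im_gt open_halfspace_Im_lt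
          convex_Int convex_halfspace_Re_gt convex_halfspace_Im_gt convex_halfspace_Im_lt)+
  have VU: "V \<subseteq> U"
  proof
    fix z assume z: "z \<in> V"
    show "z \<in> U"
    proof (cases "Re z \<ge> 0")
      case False
      have "dist (Complex 0 (Im z)) z = \<bar>Re z\<bar>"
        by (simp add: dist_norm cmod_def)
      then have "z \<in> ball (Complex 0 (Im z)) d1"
        using z False by (auto simp: V_def)
      moreover have "Complex 0 (Im z) \<in> K"
        using z by (auto simp: K_def V_def)
      ultimately show ?thesis using d1(2) by blast
    qed (use U(2) in auto)
  qed
  define B where "B = cbox (Complex (- d1 / 2) (- R)) (Complex 0 R)"
  have BV: "B \<subseteq> V"
    using d1(1) R by (auto simp: B_def V_def in_cbox_complex_iff)
  have "compact (H ` B)"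
    unfolding B_def[symmetric]
    by (intro compact_continuous_image holomorphic_on_imp_continuous_on[OF holomorphic_on_subset[OF holH]])
       (use BV VU in \<open>auto simp: B_def\<close>)
  then obtain M where M: "M > 0" "\<And>z. z \<in> B \<Longrightarrow> norm (H z) \<le> M"
    using compact_imp_bounded bounded_pos by (metis imageI)
  \<comment> \<open>\<open>M\<close> bounds \<open>H\<close> on the fixed rectangle
    \<open>B\<close>, so \<open>d\<close> can be chosen after it: the two horizontal sides of length
    \<open>d\<close> then contribute at most \<open>e\<close> together, for every N.\<close>
  define d where "d = min (d1 / 2) (e / (2 * M))"
  have d: "d > 0" "d \<le> d1 / 2" "M * d \<le> e / 2"
    using d1 M e by (auto simp: d_def min_def field_simps)
  define Cp where "Cp = part_circlepath 0 R (- (pi / 2)) (pi / 2)"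
  define Cm where "Cm = part_circlepath 0 R (pi / 2) (3 * pi / 2)"
  have ends: "pathstart Cp = - \<i> * R" "pathfinish Cp = \<i> * R" 
             "pathstart Cm = \<i> * R" "pathfinish Cm = - \<i> * R"
    using cos_3over2_pi sin_3over2_pi
    by (simp_all add: Cp_def Cm_def exp_eq_polar complex_eq_iff)
  have valid: "valid_path Cp" "valid_path Cm"
    by (simp_all add: Cp_def Cm_def)
  have imCp: "norm z = R \<and> Re z \<ge> 0" if "z \<in> path_image Cp" for z
    using that R cos_ge_zero by (force simp: Cp_def path_image_part_circlepath' norm_mult closed_segment_eq_real_ivl)
  have imCm: "norm z = R \<and> Re z \<le> 0" if z: "z \<in> path_image Cm" for z
  proof -
    obtain t where t: "t \<in> {pi/2..3*pi/2}" "z = R * cis t"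
      using z by (auto simp: Cm_def path_image_part_circlepath' closed_segment_eq_real_ivl)
    have "cos (t - pi) \<ge> 0"
      using t by (intro cos_ge_zero) auto
    then show ?thesis
      using t R by (simp add: norm_mult mult_nonneg_nonpos)
  qed
  have CpV: "path_image Cp \<subseteq> V"
  proof
    fix z assume "z \<in> path_image Cp"
    with imCp abs_Im_le_cmod[of z] have "\<bar>Im z\<bar> \<le> R" "Re z \<ge> 0" by auto
    then show "z \<in> V" using d1(1) by (auto simp: V_def)
  qed
  define S where "S = (\<lambda>N z. \<Sum>n\<le>Suc N. a n * of_nat n powr (- 1 - z))"
  \<comment> \<open>After division by 2 pi each half circle contributes C / R. The term C / (N+1)
    stems from the extra summand in \<open>norm_partial_dirichlet_le\<close>, the last two terms
    from the horizontal and the vertical sides of the detour.\<close>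
  have bound: "norm (S N 0) \<le> 2 * C / R + C / real (Suc N) + e / 2 + M * R * real (Suc N) powr (- d)" for N
  proof -
    define P where "P = (\<lambda>z. of_nat (Suc N) powr z :: complex)"
    define q where "q = (\<lambda>z. S N z * P z * (1 + z\<^sup>2 / of_real R ^ 2))"
    have holP: "P holomorphic_on X" and holq: "q holomorphic_on X" for X
      unfolding q_def P_def S_def by (intro holomorphic_intros; use R in auto)+
    have normP: "norm (P z) = real (Suc N) powr Re z" for z
      unfolding P_def by (rule norm_of_nat_powr)
    have q0: "q 0 = S N 0"
      by (simp add: q_def P_def del: of_nat_Suc)

    \<comment> \<open>Cauchy's formula by hand: q z / z is the entire function \<open>q1\<close>,
      whose primitive gives endpoint values that cancel over the full circle, plus q 0 / z, which
      integrates to \<open>\<i> * pi * q 0\<close> over each half circle.\<close>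
    define q1 where "q1 = (\<lambda>z. if z = 0 then deriv q 0 else (q z - q 0) / (z - 0))"
    have "q1 holomorphic_on UNIV"
      unfolding q1_def using holq[of UNIV] open_UNIV by (rule pole_lemma_open)
    then obtain Q1 where Q1: "\<And>z. (Q1 has_field_derivative q1 z) (at z within UNIV)"
      using holomorphic_convex_primitive'[of UNIV q1] by auto
    have inv_int: "((\<lambda>z. q 0 * (1 / z)) has_contour_integral q 0 * (\<i> * pi)) (part_circlepath 0 R s (s + pi))" for s
    proof (intro has_contour_integral_lmul)
      have "((\<lambda>t. \<i>) has_integral of_real (s + pi - s) * \<i>) {s..s+pi}"
        using has_integral_const_real[of \<i> s "s + pi"] by (simp add: scaleR_conv_of_real)
      then have "((\<lambda>t. 1 / (0 + R * cis t) * R * \<i> * cis t) has_integral (\<i> * pi)) {s..s+pi}"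
        by (rule has_integral_eq_rhs[OF has_integral_eq, rotated 1]) (use R in auto)
      then show "((\<lambda>z. 1 / z) has_contour_integral \<i> * pi) (part_circlepath 0 R s (s + pi))"
        by (subst has_contour_integral_part_circlepath_iff) auto
    qed
    have inv_Cp: "((\<lambda>z. q 0 * (1 / z)) has_contour_integral q 0 * (\<i> * pi)) Cp"
      using inv_int[of "-(pi/2)"] by (simp add: Cp_def)
    have inv_Cm: "((\<lambda>z. q 0 * (1 / z)) has_contour_integral q 0 * (\<i> * pi)) Cm"
      using inv_int[of "pi/2"] by (simp add: Cm_def)
    have nz: "z \<noteq> 0" if "z \<in> path_image Cp \<union> path_image Cm" for z
      using that imCp[of z] imCm[of z] R by auto
    have q1_Cp: "(q1 has_contour_integral (Q1 (\<i> * R) - Q1 (- \<i> * R))) Cp"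
      using contour_integral_primitive[OF Q1 valid(1)] unfolding ends by simp
    have q1_Cm: "(q1 has_contour_integral (Q1 (- \<i> * R) - Q1 (\<i> * R))) Cm"
      using contour_integral_primitive[OF Q1 valid(2)] unfolding ends by simp
    have q_Cp: "((\<lambda>z. q z / z) has_contour_integral (Q1 (\<i> * R) - Q1 (- \<i> * R)) + q 0 * (\<i> * pi)) Cp"
      by (rule has_contour_integral_eq[OF has_contour_integral_add[OF q1_Cp inv_Cp]])
         (use nz in \<open>auto simp: q1_def field_simps\<close>)
    have q_Cm: "((\<lambda>z. q z / z) has_contour_integral (Q1 (- \<i> * R) - Q1 (\<i> * R)) + q 0 * (\<i> * pi)) Cm"
      by (rule has_contour_integral_eq[OF has_contour_integral_add[OF q1_Cm inv_Cm]])
         (use nz in \<open>auto simp: q1_def field_simps\<close>)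

    have "(\<lambda>z. H z * P z) holomorphic_on V"
      by (intro holomorphic_intros holP holomorphic_on_subset[OF holH] VU)
    then obtain Q2 where Q2: "\<And>z. z \<in> V \<Longrightarrow> (Q2 has_field_derivative H z * P z) (at z within V)"
      using holomorphic_convex_primitive'[of V "\<lambda>z. H z * P z"] V by auto
    have HP_Cp: "((\<lambda>z. H z * P z) has_contour_integral (Q2 (\<i> * R) - Q2 (- \<i> * R))) Cp"
      using contour_integral_primitive[OF Q2 valid(1) CpV] unfolding ends by simp
    have HP_line: "norm (Q2 v - Q2 u) \<le> M * k * norm (v - u)"
      if uv: "u \<in> B" "v \<in> B" and k: "k \<ge> 0" "\<And>z. z \<in> closed_segment u v \<Longrightarrow> norm (P z) \<le> k" for u v k
    proof -
      have seg: "closed_segment u v \<subseteq> B"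
        unfolding B_def by (intro closed_segment_subset convex_box) (use uv in \<open>auto simp: B_def\<close>)
      have "((\<lambda>z. H z * P z) has_contour_integral Q2 v - Q2 u) (linepath u v)"
        using contour_integral_primitive[OF Q2, of "linepath u v"] seg BV by auto
      then show ?thesis
        by (rule has_contour_integral_bound_linepath)
           (use M k seg in \<open>auto simp: norm_mult intro!: mult_mono\<close>)
    qed
    have corners: "- \<i> * R \<in> B" "Complex (- d) (- R) \<in> B" "Complex (- d) R \<in> B" "\<i> * R \<in> B"
      using d R d1 by (auto simp: B_def in_cbox_complex_iff)
    have P_le_1: "norm (P z) \<le> 1" if "Re z \<le> 0" for z
      using that powr_mono[of "Re z" 0 "real (Suc N)"] by (simp add: normP)
    have l1: "norm (Q2 (Complex (- d) (- R)) - Q2 (- \<i> * R)) \<le> M * 1 * norm (Complex (- d) (- R) - (- \<i> * R))"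
      by (intro HP_line corners P_le_1) (use d in \<open>auto simp: closed_segment_def\<close>)
    have l2: "norm (Q2 (Complex (- d) R) - Q2 (Complex (- d) (- R)))
                \<le> M * real (Suc N) powr (- d) * norm (Complex (- d) R - Complex (- d) (- R))"
      by (intro HP_line corners) (auto simp: closed_segment_def normP left_diff_distrib)
    have l3: "norm (Q2 (\<i> * R) - Q2 (Complex (- d) R)) \<le> M * 1 * norm (\<i> * R - Complex (- d) R)"
      by (intro HP_line corners P_le_1) (use d in \<open>auto simp: closed_segment_def mult_le_0_iff\<close>)
    have n1: "norm (Complex (- d) (- R) - (- \<i> * R)) = d" "norm (\<i> * R - Complex (- d) R) = d"
             "norm (Complex (- d) R - Complex (- d) (- R)) = 2 * R"
      using d R by (simp_all add: cmod_def real_sqrt_mult)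
    have l: "norm (Q2 (\<i> * R) - Q2 (- \<i> * R)) \<le> e + M * real (Suc N) powr (- d) * (2 * R)"
    proof -
      have "Q2 (\<i> * R) - Q2 (- \<i> * R) = (Q2 (\<i> * R) - Q2 (Complex (- d) R)) +
        (Q2 (Complex (- d) R) - Q2 (Complex (- d) (- R))) + (Q2 (Complex (- d) (- R)) - Q2 (- \<i> * R))"
        by simp
      also have "norm \<dots> \<le> M * 1 * d + M * real (Suc N) powr (- d) * (2 * R) + M * 1 * d"
        using l1 l2 l3 unfolding n1 by (intro norm_triangle_mono)
      also have "\<dots> \<le> e + M * real (Suc N) powr (- d) * (2 * R)"
        using d by simp
      finally show ?thesis .
    qed

    have bCm: "norm ((Q1 (- \<i> * R) - Q1 (\<i> * R)) + q 0 * (\<i> * pi)) \<le> (2 * C / R\<^sup>2 + 2 * C / (R * Suc N)) * R * (3 * pi / 2 - pi / 2)"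
    proof (rule has_contour_integral_bound_part_circlepath[OF q_Cm[unfolded Cm_def], folded Cm_def])
      fix z assume z: "z \<in> path_image Cm"
      have z': "norm z = R" "Re z \<le> 0"
        using imCm[OF z] by auto
      have "q z / z = S N z * P z * of_real (2 * Re z / R\<^sup>2)"
        unfolding q_def newman_kernel[OF z'(1) R, symmetric] by simp
      then have nq: "norm (q z / z) = norm (S N z) * real (Suc N) powr Re z * (2 * \<bar>Re z\<bar> / R\<^sup>2)"
        by (simp add: norm_mult norm_divide norm_power normP)
      \<comment> \<open>The endpoints of the arc are treated apart: the estimate of the partial sum
        divides by s = 0 there, but the kernel vanishes.\<close>
      show "norm (q z / z) \<le> 2 * C / R\<^sup>2 + 2 * C / (R * Suc N)"
      proof (cases "Re z = 0")
        case True
        then show ?thesis unfolding nq using C R by simp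
      next
        case False
        define s where "s = - Re z"
        have s: "s > 0" and Re: "\<bar>Re z\<bar> = s" "Re z = - s" using False z' by (simp_all add: s_def)
        have sR: "s \<le> R" using z' abs_Re_le_cmod[of z] by (simp add: s_def)
        have "norm (S N z) \<le> C * (real (Suc N) powr (s - 1) + real (Suc N) powr s / s)"
          unfolding S_def by (intro norm_partial_dirichlet_le a s) (simp add: s_def)
        then have "norm (q z / z) \<le> C * (real (Suc N) powr (s - 1) + real (Suc N) powr s / s) *
                      real (Suc N) powr (- s) * (2 * s / R\<^sup>2)"
          unfolding nq Re(1) unfolding Re(2) using s by (intro mult_right_mono) auto
        also have "\<dots> = C * (2 * s / R\<^sup>2 * (real (Suc N) powr (s - 1) * real (Suc N) powr (- s)) +
                             2 / R\<^sup>2 * (real (Suc N) powr s * real (Suc N) powr (- s)))"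
          using s R by (simp add: field_simps del: of_nat_Suc)
        also have "\<dots> = C * (2 * s / (R\<^sup>2 * Suc N) + 2 / R\<^sup>2)"
          unfolding powr_add[symmetric] by (simp add: powr_minus divide_simps)
        also have "\<dots> \<le> C * (2 * R / (R\<^sup>2 * Suc N) + 2 / R\<^sup>2)"
          using sR R C by (intro mult_left_mono add_right_mono divide_right_mono) auto
        also have "\<dots> = 2 * C / R\<^sup>2 + 2 * C / (R * Suc N)"
        proof -
          have "2 * R / (R\<^sup>2 * Suc N) = 2 / (R * Suc N)"
            using R by (simp add: power2_eq_square del: of_nat_Suc)
          then show ?thesis
            by (simp add: distrib_left mult.commute del: of_nat_Suc)
        qed
        finally show ?thesis .
      qed
    qed (use C R in auto)

    have bCp: "norm ((Q1 (\<i> * R) - Q1 (- \<i> * R)) + q 0 * (\<i> * pi) - (Q2 (\<i> * R) - Q2 (- \<i> * R)))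
        \<le> (2 * C / R\<^sup>2) * R * (pi / 2 - - (pi / 2))"
    proof (rule has_contour_integral_bound_part_circlepath[OF 
             has_contour_integral_diff[OF q_Cp HP_Cp, unfolded Cp_def], folded Cp_def])
      fix z assume z: "z \<in> path_image Cp"
      have z': "norm z = R" "Re z \<ge> 0"
        using imCp[OF z] by auto
      have z0: "z \<noteq> 0" using z' R by auto
      have "q z / z = S N z * P z * ((1 + z\<^sup>2 / of_real R ^ 2) / z)"
        by (simp add: q_def)
      moreover have "H z * P z = F z * P z * ((1 + z\<^sup>2 / of_real R ^ 2) / z)"
        using z0 by (simp add: H_def G_def F0)
      ultimately have "q z / z - H z * P z = (S N z - F z) * P z * ((1 + z\<^sup>2 / of_real R ^ 2) / z)"
        by (simp only: left_diff_distrib)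
      also have "\<dots> = (S N z - F z) * P z * of_real (2 * Re z / R\<^sup>2)"
        unfolding newman_kernel[OF z'(1) R] by simp
      finally have nq: "norm (q z / z - H z * P z) = norm (F z - S N z) * real (Suc N) powr Re z * (2 * Re z / R\<^sup>2)"
        using z' by (simp add: norm_mult norm_divide norm_power normP norm_minus_commute)
      show "norm (q z / z - H z * P z) \<le> 2 * C / R\<^sup>2"
      proof (cases "Re z = 0")
        case True
        then show ?thesis unfolding nq using C R by simp
      next
        case False
        then have s: "Re z > 0" using z' by simp
        have "norm (F z - S N z) \<le> C * (real (Suc N) powr (- Re z) / Re z)"
          unfolding S_def by (intro norm_tail_dirichlet_le a s F)
        then have "norm (q z / z - H z * P z) \<le> C * (real (Suc N) powr (- Re z) / Re z) *
                      real (Suc N) powr Re z * (2 * Re z / R\<^sup>2)"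
          unfolding nq using s by (intro mult_right_mono) auto
        also have "\<dots> = 2 * C / R\<^sup>2"
          using s R by (simp add: powr_minus field_simps)
        finally show ?thesis .
      qed
    qed (use C R in auto)

    have "2 * pi * norm (q 0) = norm (q 0 * (2 * \<i> * pi))"
      by (simp add: norm_mult)
    \<comment> \<open>The integral of q z / z over the full circle, with the integral of
      \<open>H z * P z\<close> over the right half subtracted and added back.\<close>
    also have "q 0 * (2 * \<i> * pi) = ((Q1 (- \<i> * R) - Q1 (\<i> * R)) + q 0 * (\<i> * pi)) +
       ((Q1 (\<i> * R) - Q1 (- \<i> * R)) + q 0 * (\<i> * pi) - (Q2 (\<i> * R) - Q2 (- \<i> * R))) + (Q2 (\<i> * R) - Q2 (- \<i> * R))"
      by (simp add: algebra_simps)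
    also have "norm \<dots> \<le> (2 * C / R\<^sup>2 + 2 * C / (R * Suc N)) * R * (3 * pi / 2 - pi / 2) +
       (2 * C / R\<^sup>2) * R * (pi / 2 - - (pi / 2)) + (e + M * real (Suc N) powr (- d) * (2 * R))"
      by (intro norm_triangle_mono bCm bCp l)
    also have "\<dots> = 2 * pi * (2 * C / R + C / Suc N) + (e + M * real (Suc N) powr (- d) * (2 * R))"
      using R by (simp add: field_simps power2_eq_square del: of_nat_Suc)
    \<comment> \<open>Enlarging the detour term by pi >= 1 lets the whole bound carry the factor 2
      pi.\<close>
    also have "\<dots> \<le> 2 * pi * (2 * C / R + C / Suc N) + pi * (e + M * real (Suc N) powr (- d) * (2 * R))"
      using pi_gt3 e M R by (intro add_left_mono mult_right_mono[of 1 pi, simplified]) auto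
    also have "\<dots> = 2 * pi * (2 * C / R + C / Suc N + e / 2 + M * R * real (Suc N) powr (- d))"
      by (simp add: algebra_simps)
    finally show ?thesis
      by (simp add: q0)
  qed
  have "(\<lambda>N. C / real (Suc N) + M * R * real (Suc N) powr (- d)) \<longlonglongrightarrow> 0 + M * R * 0"
    by (intro tendsto_intros lim_const_over_n LIMSEQ_Suc[OF lim_const_over_n]
         LIMSEQ_Suc[OF tendsto_neg_powr[OF _ filterlim_real_sequentially]]) (use d in auto)
  then have "\<forall>\<^sub>F N in sequentially. C / real (Suc N) + M * R * real (Suc N) powr (- d) < e / 2"
    by (rule order_tendstoD) (use e in auto)
  then show ?thesis
  proof eventually_elim
    case (elim N)
    have "S N 0 = (\<Sum>n\<le>Suc N. a n * of_nat n powr (- 1))"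
      by (simp only: S_def diff_zero)
    then show ?case
      unfolding \<open>S N 0 = _\<close> [symmetric] using elim bound[of N] by linarith
  qed
qed

text \<open>Replacing \<open>a 1\<close> by \<open>a 1 - F 0\<close> makes \<open>F\<close> vanish at \<open>0\<close>, as the previous lemma demands.\<close>
lemma newman_tauberian:
  fixes a :: "nat \<Rightarrow> complex" and F :: "complex \<Rightarrow> complex"
  assumes a: "\<And>n. norm (a n) \<le> C"
    and U: "open U" "{z. Re z \<ge> 0} \<subseteq> U" and holF: "F holomorphic_on U"
    and F: "\<And>z. Re z > 0 \<Longrightarrow> (\<lambda>n. a n * of_nat n powr (- 1 - z)) sums F z"
  shows "(\<lambda>n. a n / of_nat n) sums F 0"
proof -
  define b where "b = (\<lambda>n. if n = 1 then a n - F 0 else a n)"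
  define C' where "C' = C + norm (F 0)"
  have b: "norm (b n) \<le> C'" for n
    using a[of n] norm_triangle_ineq4[of "a n" "F 0"]
    by (auto simp: b_def C'_def add_increasing2)
  have C': "C' \<ge> 0"
    using b[of 0] norm_ge_zero order_trans by blast
  have sums: "(\<lambda>n. b n * of_nat n powr (- 1 - z)) sums (F z - F 0)" if "Re z > 0" for z
  proof -
    have "(\<lambda>n. a n * of_nat n powr (- 1 - z) - (if n = 1 then F 0 else 0)) sums (F z - F 0)"
      using sums_single[of 1 "\<lambda>_. F 0"] by (intro sums_diff F that) simp
    also have "(\<lambda>n. a n * of_nat n powr (- 1 - z) - (if n = 1 then F 0 else 0)) = (\<lambda>n. b n * of_nat n powr (- 1 - z))"
      by (auto simp: b_def)
    finally show ?thesis .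
  qed
  have "(\<lambda>N. \<Sum>n\<le>Suc N. b n * of_nat n powr (- 1)) \<longlonglongrightarrow> 0"
  proof (rule tendstoI)
    fix e :: real assume e: "e > 0"
    \<comment> \<open>Chosen so that 2 C' / R < e / 2; the summand 1 keeps R positive when C' =
      0.\<close>
    define R where "R = 4 * (C' + 1) / e"
    have R: "R > 0" using e C' by (simp add: R_def)
    have "2 * C' / R < e / 2"
      using e C' by (simp add: R_def field_simps)
    have "\<forall>\<^sub>F N in sequentially. norm (\<Sum>n\<le>Suc N. b n * of_nat n powr (- 1)) \<le> 2 * C' / R + e / 2"
      by (rule newman_core[OF b U, of "\<lambda>z. F z - F 0"])
         (use sums e R in \<open>auto intro!: holomorphic_intros holF\<close>)
    then show "\<forall>\<^sub>F N in sequentially. dist (\<Sum>n\<le>Suc N. b n * of_nat n powr (- 1)) 0 < e"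
      by eventually_elim (use \<open>2 * C' / R < e / 2\<close> in simp)
  qed
  then have "(\<lambda>N. \<Sum>n\<le>N. b n * of_nat n powr (- 1)) \<longlonglongrightarrow> 0"
    by (rule LIMSEQ_imp_Suc)
  then have "(\<lambda>n. b n * of_nat n powr (- 1)) sums 0"
    by (simp add: sums_def_le)
  then have "(\<lambda>n. b n * of_nat n powr (- 1) + (if n = 1 then F 0 else 0)) sums (0 + F 0)"
    using sums_single[of 1 "\<lambda>_. F 0"] by (intro sums_add) simp
  also have "(\<lambda>n. b n * of_nat n powr (- 1) + (if n = 1 then F 0 else 0)) = (\<lambda>n. a n / of_nat n)"
  proof
    fix n show "b n * of_nat n powr (- 1) + (if n = 1 then F 0 else 0) = a n / of_nat n"
      by (cases "n = 0") (auto simp: b_def powr_minus divide_inverse)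
  qed
  finally show ?thesis by simp
qed

section \<open>The zeta function and the von Mangoldt series\<close>

text \<open>Weierstrass M-test on small balls. The majorant may depend on \<open>R\<close> because
  the remainders of the zeta function grow with \<open>norm s\<close>. It is required for n > 0
  only: majorants such as \<open>real n powr (- x)\<close> are 0 at n = 0, where
  \<open>powr_remainder\<close> equals 1.\<close>

lemma holomorphic_series_half_plane:
  fixes f :: "nat \<Rightarrow> complex \<Rightarrow> complex"
  assumes hol: "\<And>n. f n holomorphic_on {s. Re s > c}"
    and bound: "\<And>x R. x > c \<Longrightarrow>
      \<exists>h. summable h \<and> (\<forall>n>0. \<forall>s. x \<le> Re s \<longrightarrow> norm s \<le> R \<longrightarrow> norm (f n s) \<le> h n)"
  shows "(\<lambda>s. \<Sum>n. f n s) holomorphic_on {s. Re s > c}"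
    and "\<And>s. Re s > c \<Longrightarrow> (\<lambda>n. f n s) sums (\<Sum>n. f n s)"
    and "\<And>s. Re s > c \<Longrightarrow> (\<lambda>n. deriv (f n) s) sums deriv (\<lambda>s. \<Sum>n. f n s) s"
proof -
  let ?S = "{s. Re s > c}"
  have S: "open ?S"
    by (rule open_halfspace_Re_gt)
  have "\<exists>g g'. \<forall>s\<in>?S. (\<lambda>n. f n s) sums g s \<and> (\<lambda>n. deriv (f n) s) sums g' s \<and>
                 (g has_field_derivative g' s) (at s)"
  proof (rule series_and_derivative_comparison_local[OF S])
    show "(f n has_field_derivative deriv (f n) s) (at s)" if "s \<in> ?S" for n s
      using hol S that by (rule holomorphic_derivI)
    fix s assume s: "s \<in> ?S"
    define d where "d = (Re s - c) / 2"
    have d: "d > 0" "Re s - d > c"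
      using s by (simp_all add: d_def field_simps)
    obtain h where h: "summable h"
      "\<And>n y. n > 0 \<Longrightarrow> Re s - d \<le> Re y \<Longrightarrow> norm y \<le> norm s + d \<Longrightarrow> norm (f n y) \<le> h n"
      using bound[OF d(2), of "norm s + d"] by blast
    have "\<forall>\<^sub>F n in sequentially. \<forall>y\<in>ball s d \<inter> ?S. norm (f n y) \<le> h n"
      using eventually_gt_at_top[of 0]
    proof eventually_elim
      case (elim n)
      show ?case
      proof
        fix y assume "y \<in> ball s d \<inter> ?S"
        then have y: "norm (s - y) < d" by (auto simp: dist_norm)
        have "Re s - d \<le> Re y"
          using y abs_Re_le_cmod[of "s - y"] by simp
        moreover have "norm y \<le> norm s + d"
          using y norm_triangle_ineq3[of s y] by linarith
        ultimately show "norm (f n y) \<le> h n"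
          using h(2) elim by blast
      qed
    qed
    with d h show "\<exists>d h. 0 < d \<and> summable h \<and>
        (\<forall>\<^sub>F n in sequentially. \<forall>y\<in>ball s d \<inter> ?S. norm (f n y) \<le> h n)"
      by blast
  qed
  then obtain g g' where g: "\<And>s. s \<in> ?S \<Longrightarrow> (\<lambda>n. f n s) sums g s"
    "\<And>s. s \<in> ?S \<Longrightarrow> (\<lambda>n. deriv (f n) s) sums g' s"
    "\<And>s. s \<in> ?S \<Longrightarrow> (g has_field_derivative g' s) (at s)"
    by blast
  have eq: "(\<Sum>n. f n s) = g s" if "s \<in> ?S" for s
    using g(1)[OF that] by (simp add: sums_iff)
  have deriv: "((\<lambda>s. \<Sum>n. f n s) has_field_derivative g' s) (at s)" if "s \<in> ?S" for s
    using g(3)[OF that] that eq S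
    by (metis (no_types, lifting) has_field_derivative_transform_within_open)
  show "(\<lambda>s. \<Sum>n. f n s) holomorphic_on ?S"
    using deriv S holomorphic_on_open by blast
  show "(\<lambda>n. f n s) sums (\<Sum>n. f n s)" if "Re s > c" for s
    using g(1)[of s] eq[of s] that by simp
  show "(\<lambda>n. deriv (f n) s) sums deriv (\<lambda>s. \<Sum>n. f n s) s" if "Re s > c" for s
    using g(2)[of s] DERIV_imp_deriv[OF deriv[of s]] that by simp
qed

lemma summable_ln_powr:
  fixes x :: real
  assumes "x > 1"
  shows "summable (\<lambda>n. ln (real n) * real n powr (- x))"
proof -
  \<comment> \<open>Half of the excess over 1 pays for the logarithm, the other half for
    convergence.\<close>
  define e where "e = (x - 1) / 2"
  have e: "e > 0" using assms by (simp add: e_def)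
  have "summable (\<lambda>n. real n powr (- 1 - e) / e)"
    by (intro summable_divide summable_powr_real e)
  then show ?thesis
  proof (rule summable_comparison_test')
    fix n :: nat assume n: "n \<ge> 1"
    have "ln (real n) * real n powr (- x) \<le> real n powr e / e * real n powr (- x)"
      using n e by (intro mult_right_mono ln_powr_bound) auto
    also have "\<dots> = real n powr (- 1 - e) / e"
      by (simp add: powr_add[symmetric]) (simp add: e_def field_simps)
    finally show "norm (ln (real n) * real n powr (- x)) \<le> real n powr (- 1 - e) / e"
      using n by simp
  qed
qed

lemma powr_neg_mono:
  assumes "n > 0" "x \<le> y"
  shows "real n powr (- y) \<le> real n powr (- x)"
  using assms by (intro powr_mono) auto

text \<open>The term n = 0 vanishes since \<open>0 powr z = 0\<close>, so this is the usual series;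
  it is used only for Re s > 1.\<close>

definition zeta :: "complex \<Rightarrow> complex" where
  "zeta s = (\<Sum>n. of_nat n powr (- s))"

definition mangoldt_series :: "complex \<Rightarrow> complex" where
  "mangoldt_series s = (\<Sum>n. mangoldt n * of_nat n powr (- s))"

lemma zeta_bound:
  assumes "x > 1"
  shows "\<exists>h. summable h \<and> (\<forall>n>0. \<forall>s. x \<le> Re s \<longrightarrow> norm s \<le> R \<longrightarrow> norm (of_nat n powr (- s) :: complex) \<le> h n)"
  using summable_powr_real[of "x - 1"] assms
  by (intro exI[of _ "\<lambda>n. real n powr (- x)"]) (auto simp: norm_of_nat_powr powr_neg_mono)

lemma mangoldt_series_bound:
  assumes "x > 1"
  shows "\<exists>h. summable h \<and> (\<forall>n>0. \<forall>s. x \<le> Re s \<longrightarrow> norm s \<le> R \<longrightarrow>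
           norm (mangoldt n * of_nat n powr (- s) :: complex) \<le> h n)"
  using summable_ln_powr[OF assms]
  by (intro exI[of _ "\<lambda>n. ln (real n) * real n powr (- x)"])
     (auto simp: norm_mult norm_of_nat_powr powr_neg_mono mangoldt_nonneg intro!: mult_mono mangoldt_le)

lemma holomorphic_powr_neg: "(\<lambda>s. of_nat n powr (- s) :: complex) holomorphic_on A"
  by (intro holomorphic_intros)

lemma zeta_sums: "Re s > 1 \<Longrightarrow> (\<lambda>n. of_nat n powr (- s)) sums zeta s"
  unfolding zeta_def by (rule holomorphic_series_half_plane(2)[OF holomorphic_powr_neg zeta_bound])

lemma zeta_holomorphic: "zeta holomorphic_on {s. Re s > 1}"
  using holomorphic_series_half_plane(1)[OF holomorphic_powr_neg zeta_bound]
  by (simp add: zeta_def[abs_def])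

lemma deriv_zeta_sums:
  assumes "Re s > 1"
  shows "(\<lambda>n. of_real (ln (real n)) * of_nat n powr (- s)) sums (- deriv zeta s)"
proof -
  have "(\<lambda>n. deriv (\<lambda>s. of_nat n powr (- s) :: complex) s) sums deriv zeta s"
    using holomorphic_series_half_plane(3)[OF holomorphic_powr_neg zeta_bound assms]
    by (simp add: zeta_def[abs_def])
  moreover have "deriv (\<lambda>s. of_nat n powr (- s) :: complex) s = - (of_real (ln (real n)) * of_nat n powr (- s))" for n
  proof (cases "n = 0")
    case False
    then show ?thesis
      by (intro DERIV_imp_deriv) (auto intro!: derivative_eq_intros simp: powr_def Ln_of_nat)
  qed simp
  ultimately show ?thesis
    using sums_minus by fastforce
qed

lemma mangoldt_series_sums:
  "Re s > 1 \<Longrightarrow> (\<lambda>n. mangoldt n * of_nat n powr (- s)) sums mangoldt_series s"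
  unfolding mangoldt_series_def
  by (rule holomorphic_series_half_plane(2)[OF holomorphic_on_mult[OF holomorphic_on_const holomorphic_powr_neg]
        mangoldt_series_bound])

lemma mangoldt_series_holomorphic: "mangoldt_series holomorphic_on {s. Re s > 1}"
  using holomorphic_series_half_plane(1)[OF holomorphic_on_mult[OF holomorphic_on_const holomorphic_powr_neg]
        mangoldt_series_bound]
  by (simp add: mangoldt_series_def[abs_def])

text \<open>The double series over positive (d, k) converges absolutely and is regrouped by the
  product n = d k. At n = 0 the set of divisors is infinite, so the inner sum is 0 by convention, as
  the regrouping requires.\<close>

lemma dirichlet_convolution_sums:
  fixes f g :: "nat \<Rightarrow> complex"
  assumes f: "summable (\<lambda>n. norm (f n))" and g: "summable (\<lambda>n. norm (g n))"
    and f0: "f 0 = 0" and g0: "g 0 = 0"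
  shows "(\<lambda>n. \<Sum>d | d dvd n. f d * g (n div d)) sums (suminf f * suminf g)"
proof -
  let ?P = "{0<..} :: nat set"
  have hsP: "(h has_sum suminf h) ?P" if "summable (\<lambda>n. norm (h n))" "h 0 = 0" for h :: "nat \<Rightarrow> complex"
  proof -
    have "(h has_sum suminf h) UNIV"
      using that by (intro norm_summable_imp_has_sum summable_sums summable_norm_cancel[of h])
    also have "?this \<longleftrightarrow> ?thesis"
      using that by (intro has_sum_cong_neutral) auto
    finally show ?thesis .
  qed
  have absP: "(\<lambda>n. norm (h n)) summable_on ?P" if "(h has_sum s) ?P" for h :: "nat \<Rightarrow> complex" and s
    using that summable_on_iff_abs_summable_on_complex summable_on_def by blast
  have smP: "(\<lambda>(d, k). f d * g k) summable_on ?P \<times> ?P"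
    unfolding summable_on_iff_abs_summable_on_complex
    using absP[OF hsP[OF f f0]] absP[OF hsP[OF g g0]]
    by (intro Infinite_Sum.abs_summable_on_Sigma_iff [THEN iffD2])
       (auto simp: norm_mult infsum_cmult_right' abs_mult intro!: summable_on_cmult_right summable_on_cmult_left)
  have "((\<lambda>(d, k). f d * g k) has_sum (suminf f * suminf g)) (?P \<times> ?P)"
    using hsP[OF f f0] hsP[OF g g0] smP
    by (intro has_sum_SigmaI[where g = "\<lambda>d. f d * suminf g"])
       (auto intro!: has_sum_cmult_right has_sum_cmult_left)
  also have "?this \<longleftrightarrow> ((\<lambda>(n, d). f d * g (n div d)) has_sum (suminf f * suminf g)) (Sigma ?P (\<lambda>n. {d. d dvd n}))"
    by (rule has_sum_reindex_bij_witness[where i = "\<lambda>(n, d). (d, n div d)" and j = "\<lambda>(d, k). (d * k, d)"])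
       (auto elim!: dvdE)
  finally have "((\<lambda>n. \<Sum>d | d dvd n. f d * g (n div d)) has_sum (suminf f * suminf g)) ?P"
    by (rule has_sum_SigmaD) (auto intro!: has_sum_finiteI)
  also have "?this \<longleftrightarrow> ((\<lambda>n. \<Sum>d | d dvd n. f d * g (n div d)) has_sum (suminf f * suminf g)) UNIV"
    by (intro has_sum_cong_neutral) (auto simp: infinite_UNIV_nat)
  finally show ?thesis
    by (rule has_sum_imp_sums)
qed

text \<open>The convolution of \<open>mangoldt\<close> with the constant 1 is the logarithm, and
  n^(-s) is multiplicative in n. The product form makes no use of division by \<open>zeta\<close>,
  so it can serve in the proof that \<open>zeta\<close> has no zeros.\<close>

lemma deriv_zeta_eq:
  assumes s: "Re s > 1"
  shows "deriv zeta s = - (mangoldt_series s * zeta s)"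
proof -
  let ?f = "\<lambda>n. mangoldt n * of_nat n powr (- s) :: complex" and ?g = "\<lambda>n. of_nat n powr (- s) :: complex"
  have "summable (\<lambda>n. norm (?f n))"
    by (rule summable_comparison_test'[OF summable_ln_powr[OF s], of 1])
       (auto simp: norm_mult norm_of_nat_powr abs_mult intro!: mult_right_mono mangoldt_le)
  moreover have "summable (\<lambda>n. norm (?g n))"
    using summable_powr_real[of "Re s - 1"] s by (simp add: norm_of_nat_powr)
  ultimately have "(\<lambda>n. \<Sum>d | d dvd n. ?f d * ?g (n div d)) sums (suminf ?f * suminf ?g)"
    by (rule dirichlet_convolution_sums) auto
  moreover have "(\<Sum>d | d dvd n. ?f d * ?g (n div d)) = of_real (ln (real n)) * of_nat n powr (- s)" for n
  proof (cases "n = 0")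
    case False
    have "(\<Sum>d | d dvd n. ?f d * ?g (n div d)) = (\<Sum>d | d dvd n. mangoldt d * of_nat n powr (- s))"
    proof (intro sum.cong refl)
      fix d assume "d \<in> {d. d dvd n}"
      then obtain k where k: "n = d * k" by auto
      then have "of_nat n powr (- s) = of_nat d powr (- s) * (of_nat k powr (- s) :: complex)"
        by (simp add: powr_times_real)
      then show "?f d * ?g (n div d) = mangoldt d * of_nat n powr (- s)"
        using k False by simp
    qed
    also have "\<dots> = of_real (ln (real n)) * of_nat n powr (- s)"
      using mangoldt_sum[OF False, where ?'a = complex] by (simp add: sum_distrib_right[symmetric])
    finally show ?thesis .
  qed (simp add: infinite_UNIV_nat)
  ultimately have "(\<lambda>n. of_real (ln (real n)) * of_nat n powr (- s)) sums (mangoldt_series s * zeta s)"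
    by (simp add: mangoldt_series_def zeta_def)
  with deriv_zeta_sums[OF s] have "- deriv zeta s = mangoldt_series s * zeta s"
    by (rule sums_unique2)
  then show ?thesis
    by (metis minus_minus)
qed

section \<open>The zeta function with its pole removed\<close>

text \<open>For \<open>n > 0\<close> this is \<open>s - 1\<close> times the difference of \<open>n powr (- s)\<close> and the integral of
  \<open>x powr (- s)\<close> over \<open>[n, n + 1]\<close>. Because \<open>0 powr z = 0\<close> for every \<open>z\<close>, the value at \<open>n = 0\<close> is \<open>1\<close>,
  which accounts for the residue of the zeta function at \<open>1\<close>.\<close>
definition powr_remainder :: "nat \<Rightarrow> complex \<Rightarrow> complex" where
  "powr_remainder n s = (s - 1) * of_nat n powr (- s) + of_nat (Suc n) powr (1 - s) - of_nat n powr (1 - s)"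

text \<open>Up to the factor (s - 1), which is kept, this is the error of the first-order Taylor
  polynomial of x^(1-s) at n, evaluated at n + 1. The second derivative is s (s - 1) x^(-1-s), and
  Re s >= -1 makes its modulus largest at x = n on the ray [n, oo).\<close>

lemma norm_powr_remainder_le:
  assumes n: "n > 0" and s: "Re s \<ge> - 1"
  shows "norm (powr_remainder n s) \<le> norm s * norm (s - 1) * real n powr (- 1 - Re s)"
proof -
  let ?S = "complex_of_real ` {real n..}"
  define f where "f = (\<lambda>i::nat. \<lambda>z. if i = 0 then z powr (1 - s) else if i = 1 then (1 - s) * z powr (- s)
                  else (1 - s) * (- s) * z powr (- s - 1))"
  have "convex ?S"
    by (intro convex_linear_image) (auto intro: bounded_linear.linear[OF bounded_linear_of_real])
  moreover have "(f i has_field_derivative f (Suc i) z) (at z within ?S)" if z: "z \<in> ?S" and i: "i \<le> 1" for i z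
  proof (rule has_field_derivative_at_within)
    have z: "z \<notin> \<real>\<^sub>\<le>\<^sub>0" using z n by auto
    consider "i = 0" | "i = 1" using i by linarith
    then show "(f i has_field_derivative f (Suc i) z) (at z)"
    proof cases
      case 1
      then have "f i = (\<lambda>z. z powr (1 - s))" "f (Suc i) z = (1 - s) * z powr (1 - s - 1)"
        by (auto simp: f_def)
      then show ?thesis using has_field_derivative_powr[OF z, of "1 - s"] by simp
    next
      case 2
      then have "f i = (\<lambda>z. (1 - s) * z powr (- s))" "f (Suc i) z = (1 - s) * (- s * z powr (- s - 1))"
        by (auto simp: f_def)
      then show ?thesis using DERIV_cmult[OF has_field_derivative_powr[OF z, of "- s"], of "1 - s"] by simp
    qed
  qed
  moreover have "norm (f (Suc 1) z) \<le> norm s * norm (s - 1) * real n powr (- 1 - Re s)" if z: "z \<in> ?S" for z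
  proof -
    obtain x where x: "z = of_real x" "x \<ge> real n" using z by auto
    have "norm (z powr (- s - 1)) = x powr (- 1 - Re s)"
      using x n by (simp add: norm_powr_real_powr minus_diff_commute)
    also have "\<dots> \<le> real n powr (- 1 - Re s)"
      using x n s by (intro powr_mono2') auto
    finally have "norm s * norm (s - 1) * norm (z powr (- s - 1)) \<le> norm s * norm (s - 1) * real n powr (- 1 - Re s)"
      by (rule mult_left_mono) auto
    then show ?thesis
      by (simp add: f_def norm_mult norm_minus_commute mult.commute)
  qed
  ultimately have "norm (f 0 (of_nat (Suc n)) - (\<Sum>i\<le>1. f i (of_nat n) * (of_nat (Suc n) - of_nat n) ^ i / fact i))
      \<le> norm s * norm (s - 1) * real n powr (- 1 - Re s) * norm (of_nat (Suc n) - of_nat n :: complex) ^ Suc 1 / fact 1"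
    by (rule complex_Taylor) (auto intro: image_eqI[of _ _ "real n"] image_eqI[of _ _ "real (Suc n)"])
  then show ?thesis
    by (simp add: f_def powr_remainder_def algebra_simps)
qed

text \<open>The function Z(s) = (s - 1) zeta(s), written as a series that converges for Re s >
  0.\<close>

definition zeta_reg :: "complex \<Rightarrow> complex" where
  "zeta_reg s = (\<Sum>n. powr_remainder n s)"

lemma holomorphic_powr_remainder: "powr_remainder n holomorphic_on A"
  unfolding powr_remainder_def by (intro holomorphic_intros)

lemma zeta_reg_holomorphic: "zeta_reg holomorphic_on {s. Re s > 0}"
  unfolding zeta_reg_def[abs_def]
proof (rule holomorphic_series_half_plane(1)[OF holomorphic_powr_remainder])
  fix x R :: real assume x: "x > 0"
  have "norm (powr_remainder n s) \<le> R * (R + 1) * real n powr (- 1 - x)"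
    if "n > 0" "x \<le> Re s" "norm s \<le> R" for n s
  proof -
    have "norm (s - 1) \<le> R + 1"
      using norm_triangle_ineq4[of s 1] that by simp
    moreover have "R \<ge> 0"
      using that norm_ge_zero order_trans by blast
    moreover have "real n powr (- 1 - Re s) \<le> real n powr (- 1 - x)"
      using that by (intro powr_mono) auto
    ultimately have "norm s * norm (s - 1) * real n powr (- 1 - Re s) \<le> R * (R + 1) * real n powr (- 1 - x)"
      using that by (intro mult_mono) auto
    with norm_powr_remainder_le[of n s] that x show ?thesis by simp
  qed
  then show "\<exists>h. summable h \<and> (\<forall>n>0. \<forall>s. x \<le> Re s \<longrightarrow> norm s \<le> R \<longrightarrow> norm (powr_remainder n s) \<le> h n)"
    using summable_powr_real[OF x]
    by (intro exI[of _ "\<lambda>n. R * (R + 1) * real n powr (- 1 - x)"]) (auto intro: summable_mult)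
qed

lemma zeta_reg_1: "zeta_reg 1 = 1"
proof -
  have "powr_remainder n 1 = (if n = 0 then 1 else 0)" for n
    by (auto simp: powr_remainder_def simp del: of_nat_Suc)
  then show ?thesis
    using sums_single[of 0 "\<lambda>_. 1 :: complex"] by (simp add: zeta_reg_def sums_iff)
qed

lemma zeta_reg_eq:
  assumes s: "Re s > 1"
  shows "zeta_reg s = (s - 1) * zeta s"
proof -
  have "(\<lambda>n. of_nat n powr (1 - s) :: complex) \<longlonglongrightarrow> 0"
  proof (rule tendsto_norm_zero_cancel)
    show "(\<lambda>n. norm (of_nat n powr (1 - s) :: complex)) \<longlonglongrightarrow> 0"
      using tendsto_neg_powr[OF _ filterlim_real_sequentially, of "1 - Re s"] s
      by (simp add: norm_of_nat_powr)
  qed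
  \<comment> \<open>Both ends of the telescope vanish: the limit because Re s > 1, the initial term
    because \<open>0 powr (1 - s) = 0\<close>.\<close>
  then have "(\<lambda>n. of_nat (Suc n) powr (1 - s) - of_nat n powr (1 - s)) sums (0 - (of_nat 0 powr (1 - s) :: complex))"
    by (rule telescope_sums)
  then have "(\<lambda>n. (s - 1) * of_nat n powr (- s) + (of_nat (Suc n) powr (1 - s) - of_nat n powr (1 - s)))
               sums ((s - 1) * zeta s + 0)"
    by (intro sums_add sums_mult zeta_sums s) simp
  then show ?thesis
    by (simp add: sums_iff zeta_reg_def powr_remainder_def add_diff_eq)
qed

section \<open>Nonvanishing on the line of real part 1\<close>

text \<open>The linear differential equation \<open>zeta' = - mangoldt_series * zeta\<close> shows that \<open>zeta\<close> is a constant
  multiple of an exponential, and the constant is nonzero as \<open>zeta_reg 1 = 1\<close>.\<close>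
lemma zeta_nonzero:
  assumes s: "Re s > 1"
  shows "zeta s \<noteq> 0"
proof
  assume z: "zeta s = 0"
  let ?S = "{s. Re s > 1}"
  have S: "open ?S" "convex ?S"
    by (rule open_halfspace_Re_gt, rule convex_halfspace_Re_gt)
  obtain P where P: "\<And>x. x \<in> ?S \<Longrightarrow> (P has_field_derivative mangoldt_series x) (at x within ?S)"
    using holomorphic_convex_primitive'[OF S(2,1) mangoldt_series_holomorphic] by blast
  have "((\<lambda>x. zeta x * exp (P x)) has_field_derivative 0) (at x within ?S)" if x: "x \<in> ?S" for x
  proof -
    have 1: "(zeta has_field_derivative deriv zeta x) (at x within ?S)"
      using holomorphic_derivI[OF zeta_holomorphic S(1) x] by (rule has_field_derivative_at_within)
    have 2: "((\<lambda>x. exp (P x)) has_field_derivative exp (P x) * mangoldt_series x) (at x within ?S)"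
      by (rule DERIV_chain2[OF DERIV_exp P[OF x]])
    have 3: "deriv zeta x * exp (P x) + exp (P x) * mangoldt_series x * zeta x = 0"
      using x by (simp add: deriv_zeta_eq)
    show ?thesis
      using DERIV_mult[OF 1 2] unfolding 3 .
  qed
  then have "\<exists>c. \<forall>x\<in>?S. zeta x * exp (P x) = c"
    by (rule has_field_derivative_zero_constant[OF S(2)])
  then obtain c where c: "\<And>x. x \<in> ?S \<Longrightarrow> zeta x * exp (P x) = c"
    by blast
  \<comment> \<open>A single zero forces c = 0. As exp has no zeros, \<open>zeta\<close> and hence
    \<open>zeta_reg\<close> then vanish on the whole half-plane, and continuity along 1 + 1/(n+1)
    contradicts \<open>zeta_reg 1 = 1\<close>.\<close>
  have "c = 0"
    using c[of s] s z by simp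
  then have zero: "zeta_reg x = 0" if "Re x > 1" for x
    using c[of x] that zeta_reg_eq[of x] by simp
  have "isCont zeta_reg 1"
    using zeta_reg_holomorphic
    by (intro holomorphic_on_imp_continuous_on[THEN continuous_on_interior])
       (auto simp: interior_open open_halfspace_Re_gt)
  moreover have "(\<lambda>n. 1 + inverse (of_nat (Suc n)) :: complex) \<longlonglongrightarrow> 1 + 0"
    by (intro tendsto_intros LIMSEQ_inverse_real_of_nat LIMSEQ_Suc[OF lim_inverse_n])
  ultimately have "(\<lambda>n. zeta_reg (1 + inverse (of_nat (Suc n)))) \<longlonglongrightarrow> zeta_reg 1"
    by (intro isCont_tendsto_compose[where g = zeta_reg]) simp_all
  moreover have "zeta_reg (1 + inverse (of_nat (Suc n))) = 0" for n
  proof (rule zero)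
    have "inverse (of_nat (Suc n)) = complex_of_real (inverse (real (Suc n)))"
      by simp
    then show "Re (1 + inverse (of_nat (Suc n))) > 1"
      by (simp only: plus_complex.sel Re_complex_of_real) simp
  qed
  ultimately show False
    by (simp add: zeta_reg_1 LIMSEQ_const_iff)
qed

lemma mangoldt_series_eq:
  assumes s: "Re s > 1"
  shows "mangoldt_series s = 1 / (s - 1) - deriv zeta_reg s / zeta_reg s"
proof -
  have s1: "s - 1 \<noteq> 0" using s by auto
  have "((\<lambda>s. (s - 1) * zeta s) has_field_derivative zeta s + (s - 1) * deriv zeta s) (at s)"
    using holomorphic_derivI[OF zeta_holomorphic open_halfspace_Re_gt, of s] s
    by (auto intro!: derivative_eq_intros)
  then have "(zeta_reg has_field_derivative zeta s + (s - 1) * deriv zeta s) (at s)"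
    by (rule has_field_derivative_transform_within_open[OF _ open_halfspace_Re_gt[of 1]])
       (use s zeta_reg_eq in auto)
  then have "deriv zeta_reg s = zeta s - (s - 1) * (mangoldt_series s * zeta s)"
    using deriv_zeta_eq[OF s] by (simp add: DERIV_imp_deriv)
  then show ?thesis
    using zeta_nonzero[OF s] s1 by (simp add: zeta_reg_eq s divide_simps)
qed

text \<open>With m the order of the zero, f w = g w (w - z)^m and g z is nonzero, so f'/f = g'/g +
  m/(w - z); the factor h = w - z isolates m.\<close>

lemma logderiv_tendsto_order:
  fixes f :: "complex \<Rightarrow> complex"
  assumes f: "f holomorphic_on S" and S: "open S" "connected S" "z \<in> S" and nz: "\<exists>w\<in>S. f w \<noteq> 0"
  obtains m :: nat where "m = 0 \<longleftrightarrow> f z \<noteq> 0"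
    "((\<lambda>h. of_real h * (deriv f (z + of_real h) / f (z + of_real h))) \<longlongrightarrow> of_nat m) (at_right 0)"
proof -
  define m where "m = nat (zorder f z)"
  define g where "g = zor_poly f z"
  obtain r where r: "r > 0" "cball z r \<subseteq> S" "g holomorphic_on cball z r"
     and fg: "\<And>w. w \<in> cball z r \<Longrightarrow> f w = g w * (w - z) ^ m \<and> g w \<noteq> 0"
     and m: "if f z = 0 then zorder f z > 0 else zorder f z = 0"
    using zorder_exist_zero[OF f S nz] unfolding m_def g_def by blast
  have holg: "g holomorphic_on ball z r"
    using r(3) by (rule holomorphic_on_subset) auto
  have lim: "((\<lambda>h. z + of_real h) \<longlongrightarrow> z) (at_right (0 :: real))"
    by (auto intro!: tendsto_eq_intros)
  have cont: "isCont g z" "isCont (deriv g) z"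
    using holomorphic_on_imp_continuous_on[OF holg] 
      holomorphic_on_imp_continuous_on[OF holomorphic_deriv[OF holg open_ball]] r(1)
    by (auto simp: continuous_on_eq_continuous_at)
  have "((\<lambda>h. of_real h * (deriv g (z + of_real h) / g (z + of_real h)) + of_nat m)
      \<longlongrightarrow> of_real 0 * (deriv g z / g z) + of_nat m) (at_right 0)"
    using fg[of z] r(1)
    by (intro tendsto_intros isCont_tendsto_compose[OF cont(1) lim] isCont_tendsto_compose[OF cont(2) lim]) auto
  moreover have "\<forall>\<^sub>F h in at_right 0. of_real h * (deriv g (z + of_real h) / g (z + of_real h)) + of_nat m
                   = of_real h * (deriv f (z + of_real h) / f (z + of_real h))"
  proof (rule eventually_at_rightI[of 0 r])
    fix h :: real assume "h \<in> {0<..<r}"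
    then have h: "h > 0" "h < r" by auto
    define w where "w = z + of_real h"
    have w: "w \<in> ball z r" and wz: "w - z = of_real h"
      using h by (auto simp: w_def dist_norm)
    have "((\<lambda>w. g w * (w - z) ^ m) has_field_derivative
            deriv g w * (w - z) ^ m + g w * (of_nat m * (w - z) ^ (m - 1))) (at w)"
      using holomorphic_derivI[OF holg open_ball w] by (auto intro!: derivative_eq_intros)
    then have "(f has_field_derivative deriv g w * (w - z) ^ m + g w * (of_nat m * (w - z) ^ (m - 1))) (at w)"
      by (rule has_field_derivative_transform_within_open[OF _ open_ball w]) (use fg in auto)
    then have "deriv f w = deriv g w * (w - z) ^ m + g w * (of_nat m * (w - z) ^ (m - 1))"
      by (rule DERIV_imp_deriv)
    moreover have "f w = g w * (w - z) ^ m" "g w \<noteq> 0"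
      using fg w by auto
    \<comment> \<open>For m = 0 the exponent m - 1 is truncated to 0, but the factor m makes both
      sides 0.\<close>
    moreover have "of_real h * (of_nat m * of_real h ^ (m - 1)) = of_nat m * (of_real h ^ m :: complex)"
      by (cases m) auto
    ultimately have *: "of_real h * deriv f w = (of_real h * (deriv g w / g w) + of_nat m) * f w"
      unfolding wz by (simp add: distrib_right distrib_left mult_ac)
    have "f w \<noteq> 0"
      using fg[of w] w h wz by auto
    with * have "of_real h * (deriv f w / f w) = of_real h * (deriv g w / g w) + of_nat m"
      by (metis nonzero_mult_div_cancel_right times_divide_eq_right)
    then show "of_real h * (deriv g (z + of_real h) / g (z + of_real h)) + of_nat m
                   = of_real h * (deriv f (z + of_real h) / f (z + of_real h))"
      by (simp add: w_def)
  qed (use r in auto)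
  ultimately have "((\<lambda>h. of_real h * (deriv f (z + of_real h) / f (z + of_real h))) \<longlongrightarrow> of_nat m) (at_right 0)"
    by (auto elim: Lim_transform_eventually)
  moreover have "m = 0 \<longleftrightarrow> f z \<noteq> 0"
    using m by (auto simp: m_def split: if_splits)
  ultimately show ?thesis
    by (intro that)
qed

lemma Re_powr_neg:
  assumes "n > 0"
  shows "Re (of_nat n powr (- Complex x u)) = real n powr (- x) * cos (u * ln (real n))"
  using assms by (simp add: powr_def Re_exp Ln_of_nat cos_minus[of "u * ln (real n)", symmetric] del: cos_minus)

lemma mangoldt_series_3_4_1:
  assumes "x > 1"
  shows "Re (3 * mangoldt_series (Complex x 0) + 4 * mangoldt_series (Complex x t) +
             mangoldt_series (Complex x (2 * t))) \<ge> 0"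
proof -
  let ?a = "\<lambda>u n. mangoldt n * of_nat n powr (- Complex x u) :: complex"
  have ser: "(\<lambda>n. Re (3 * ?a 0 n + 4 * ?a t n + ?a (2 * t) n)) sums
          Re (3 * mangoldt_series (Complex x 0) + 4 * mangoldt_series (Complex x t) +
             mangoldt_series (Complex x (2 * t)))"
    by (intro sums_Re sums_add sums_mult mangoldt_series_sums) (use assms in auto)
  have nonneg: "0 \<le> Re (3 * ?a 0 n + 4 * ?a t n + ?a (2 * t) n)" for n
  proof (cases "n = 0")
    case False
    define y where "y = t * ln (real n)"
    have Re_a: "Re (?a u n) = mangoldt n * (real n powr (- x) * cos (u * ln (real n)))" for u
      using Re_powr_neg[of n x u] False by simp
    have "Re (3 * ?a 0 n + 4 * ?a t n + ?a (2 * t) n) = 3 * Re (?a 0 n) + 4 * Re (?a t n) + Re (?a (2 * t) n)"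
      by simp
    also have "\<dots> = mangoldt n * real n powr (- x) * (3 + 4 * cos y + cos (2 * y))"
      unfolding Re_a by (simp add: y_def algebra_simps)
    also have "3 + 4 * cos y + cos (2 * y) = 2 * (1 + cos y)\<^sup>2"
      using cos_double_cos[of y] by (simp add: power2_eq_square algebra_simps)
    finally show ?thesis
      by (simp add: mangoldt_nonneg)
  qed simp
  show ?thesis
    by (rule sums_le[OF nonneg sums_zero ser])
qed

text \<open>On the line, h times the real part of \<open>mangoldt_series\<close> at 1 + h + iu tends
  to minus the order of the zero of \<open>zeta_reg\<close> at 1 + iu, plus 1 from the pole if u =
  0. For u = 0, t, 2t the 3-4-1 inequality becomes 3 - 4 m1 - m2 >= 0 in the limit, which forces m1
  = 0 because 4 > 3.\<close>

lemma zeta_reg_nonzero: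
  assumes s: "Re s \<ge> 1"
  shows "zeta_reg s \<noteq> 0"
proof (cases "Re s = 1")
  case False
  then show ?thesis
    using s zeta_reg_eq[of s] zeta_nonzero[of s] by auto
next
  case True
  define t where "t = Im s"
  have s: "s = Complex 1 t"
    using True by (simp add: t_def complex_eq_iff)
  let ?S = "{s. Re s > 0}"
  have S: "open ?S" "connected ?S"
    by (auto intro: open_halfspace_Re_gt convex_connected convex_halfspace_Re_gt)
  have ex: "\<exists>w\<in>?S. zeta_reg w \<noteq> 0"
    by (intro bexI[of _ 1]) (auto simp: zeta_reg_1)
  have lim: "\<exists>m::nat. (m = 0 \<longleftrightarrow> zeta_reg (Complex 1 u) \<noteq> 0) \<and>
      ((\<lambda>h. h * Re (mangoldt_series (Complex (1 + h) u))) \<longlongrightarrow> (if u = 0 then 1 else 0) - real m) (at_right 0)" for u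
  proof -
    have "Complex 1 u \<in> ?S"
      by simp
    then obtain m :: nat where m: "m = 0 \<longleftrightarrow> zeta_reg (Complex 1 u) \<noteq> 0"
      "((\<lambda>h. of_real h * (deriv zeta_reg (Complex 1 u + of_real h) / zeta_reg (Complex 1 u + of_real h)))
           \<longlongrightarrow> of_nat m) (at_right 0)"
      by (rule logderiv_tendsto_order[OF zeta_reg_holomorphic S _ ex])
    have "((\<lambda>h. of_real h / (\<i> * of_real u + of_real h)) \<longlongrightarrow> (if u = 0 then 1 else 0)) (at_right (0 :: real))"
    proof (cases "u = 0")
      case True
      have "((\<lambda>h. of_real h / (\<i> * of_real u + of_real h)) \<longlongrightarrow> (1 :: complex)) (at_right (0 :: real))"
        using True by (intro tendsto_eventually eventually_at_rightI[of 0 1]) auto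
      then show ?thesis using True by simp
    next
      case False
      have "((\<lambda>h. of_real h / (\<i> * of_real u + of_real h)) \<longlongrightarrow> of_real 0 / (\<i> * of_real u + of_real 0 :: complex)) (at_right (0 :: real))"
        by (intro tendsto_intros) (use False in auto)
      then show ?thesis using False by simp
    qed
    from tendsto_Re[OF tendsto_diff[OF this m(2)]]
    have "((\<lambda>h. Re (of_real h / (\<i> * of_real u + of_real h) -
              of_real h * (deriv zeta_reg (Complex 1 u + of_real h) / zeta_reg (Complex 1 u + of_real h))))
           \<longlongrightarrow> (if u = 0 then 1 else 0) - real m) (at_right (0 :: real))"
      by (simp split: if_splits)
    moreover have "\<forall>\<^sub>F h in at_right 0. Re (of_real h / (\<i> * of_real u + of_real h) -
              of_real h * (deriv zeta_reg (Complex 1 u + of_real h) / zeta_reg (Complex 1 u + of_real h)))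
              = h * Re (mangoldt_series (Complex (1 + h) u))"
    proof (rule eventually_at_rightI[of 0 1])
      fix h :: real assume "h \<in> {0<..<1}"
      then have h: "Re (Complex (1 + h) u) > 1" by auto
      have eq: "Complex 1 u + of_real h = Complex (1 + h) u" "Complex (1 + h) u - 1 = \<i> * of_real u + of_real h"
        by (simp_all add: complex_eq_iff)
      have "Re (of_real h / (\<i> * of_real u + of_real h) -
              of_real h * (deriv zeta_reg (Complex 1 u + of_real h) / zeta_reg (Complex 1 u + of_real h)))
            = Re (of_real h * mangoldt_series (Complex (1 + h) u))"
        unfolding mangoldt_series_eq[OF h] eq by (simp add: right_diff_distrib)
      then show "Re (of_real h / (\<i> * of_real u + of_real h) -
              of_real h * (deriv zeta_reg (Complex 1 u + of_real h) / zeta_reg (Complex 1 u + of_real h)))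
              = h * Re (mangoldt_series (Complex (1 + h) u))"
        by simp
    qed simp
    ultimately have "((\<lambda>h. h * Re (mangoldt_series (Complex (1 + h) u))) \<longlongrightarrow> (if u = 0 then 1 else 0) - real m) (at_right 0)"
      by (rule Lim_transform_eventually)
    with m(1) show ?thesis
      by (intro exI[of _ m] conjI)
  qed
  show ?thesis
  proof (cases "t = 0")
    case True
    then show ?thesis
      using zeta_reg_1 s by (simp add: one_complex.code[symmetric])
  next
    case False
    from lim[of 0] obtain m0 :: nat where m0: "(m0 = 0 \<longleftrightarrow> zeta_reg (Complex 1 0) \<noteq> 0) \<and>
        ((\<lambda>h. h * Re (mangoldt_series (Complex (1 + h) 0))) \<longlongrightarrow> (if (0 :: real) = 0 then 1 else 0) - real m0) (at_right 0)" ..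
    from lim[of t] obtain m1 :: nat where m1: "(m1 = 0 \<longleftrightarrow> zeta_reg (Complex 1 t) \<noteq> 0) \<and>
        ((\<lambda>h. h * Re (mangoldt_series (Complex (1 + h) t))) \<longlongrightarrow> (if t = 0 then 1 else 0) - real m1) (at_right 0)" ..
    from lim[of "2 * t"] obtain m2 :: nat where m2: "(m2 = 0 \<longleftrightarrow> zeta_reg (Complex 1 (2 * t)) \<noteq> 0) \<and>
        ((\<lambda>h. h * Re (mangoldt_series (Complex (1 + h) (2 * t)))) \<longlongrightarrow> (if (2 * t) = 0 then 1 else 0) - real m2) (at_right 0)" ..
    have "m0 = 0"
      using m0[THEN conjunct1] zeta_reg_1 by (simp add: one_complex.code[symmetric])
    then have lim0: "((\<lambda>h. h * Re (mangoldt_series (Complex (1 + h) 0))) \<longlongrightarrow> 1) (at_right 0)"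
      using m0[THEN conjunct2] by simp
    have lim1: "((\<lambda>h. h * Re (mangoldt_series (Complex (1 + h) t))) \<longlongrightarrow> - real m1) (at_right 0)"
      using m1[THEN conjunct2] False by simp
    have lim2: "((\<lambda>h. h * Re (mangoldt_series (Complex (1 + h) (2 * t)))) \<longlongrightarrow> - real m2) (at_right 0)"
      using m2[THEN conjunct2] False by simp
    have "((\<lambda>h. 3 * (h * Re (mangoldt_series (Complex (1 + h) 0))) + 4 * (h * Re (mangoldt_series (Complex (1 + h) t)))
             + h * Re (mangoldt_series (Complex (1 + h) (2 * t)))) \<longlongrightarrow> 3 * 1 + 4 * (- real m1) + (- real m2)) (at_right 0)"
      by (intro tendsto_intros lim0 lim1 lim2)
    moreover have "\<forall>\<^sub>F h in at_right 0. 0 \<le> 3 * (h * Re (mangoldt_series (Complex (1 + h) 0))) +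
         4 * (h * Re (mangoldt_series (Complex (1 + h) t))) + h * Re (mangoldt_series (Complex (1 + h) (2 * t)))"
    proof (rule eventually_at_rightI[of 0 1])
      fix h :: real assume h: "h \<in> {0<..<1}"
      then have "0 \<le> h * Re (3 * mangoldt_series (Complex (1 + h) 0) + 4 * mangoldt_series (Complex (1 + h) t) +
             mangoldt_series (Complex (1 + h) (2 * t)))"
        using mangoldt_series_3_4_1[of "1 + h" t] by (intro mult_nonneg_nonneg) auto
      then show "0 \<le> 3 * (h * Re (mangoldt_series (Complex (1 + h) 0))) +
         4 * (h * Re (mangoldt_series (Complex (1 + h) t))) + h * Re (mangoldt_series (Complex (1 + h) (2 * t)))"
        by (simp add: algebra_simps)
    qed simp
    ultimately have "3 * 1 + 4 * (- real m1) + (- real m2) \<ge> 0"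
      by (rule tendsto_lowerbound) simp
    then have "m1 = 0"
      by (cases m1) auto
    then show ?thesis
      using m1[THEN conjunct1] s by simp
  qed
qed

section \<open>The Chebyshev function\<close>

definition psi :: "nat \<Rightarrow> real" where
  "psi n = (\<Sum>d\<le>n. mangoldt d)"

lemma psi_mono: "m \<le> n \<Longrightarrow> psi m \<le> psi n"
  unfolding psi_def by (intro sum_mono2) (auto simp: mangoldt_nonneg)

lemma psi_nonneg: "psi n \<ge> 0"
  unfolding psi_def by (intro sum_nonneg mangoldt_nonneg)

text \<open>Legendre's formula. From n to n + 1 the quotient by d grows by 1 exactly when d divides
  n + 1, and \<open>mangoldt\<close> summed over these divisors is ln (n + 1). The free cutoff
  \<open>K\<close> puts n! and (2n)! over the same range of d.\<close>

lemma ln_fact_eq_sum_mangoldt: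
  "n \<le> K \<Longrightarrow> ln (fact n) = (\<Sum>d=1..K. mangoldt d * real (n div d))"
proof (induction n)
  case (Suc n)
  have "(\<Sum>d=1..K. mangoldt d * real (Suc n div d)) =
        (\<Sum>d=1..K. mangoldt d * real (n div d)) + (\<Sum>d=1..K. if d dvd Suc n then mangoldt d else 0)"
    unfolding sum.distrib[symmetric]
    by (intro sum.cong refl) (auto simp: div_Suc dvd_eq_mod_eq_0 algebra_simps)
  also have "(\<Sum>d=1..K. if d dvd Suc n then mangoldt d else 0 :: real) = (\<Sum>d | d dvd Suc n. mangoldt d)"
  proof -
    have "1 \<le> d \<and> d \<le> K" if "d dvd Suc n" for d
      using that dvd_imp_le[OF that] Suc.prems by (cases "d = 0") auto
    then show ?thesis
      by (intro sum.mono_neutral_cong_right) auto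
  qed
  also have "\<dots> = ln (real (Suc n))"
    using mangoldt_sum[of "Suc n", where ?'a = real] by simp
  finally show ?case
    using Suc by (simp add: ln_mult)
qed simp

text \<open>The logarithm of the central binomial coefficient weights \<open>mangoldt d\<close> by
  (2n div d) - 2 (n div d), which is never negative and is at least 1 for n < d <= 2n; the
  coefficient itself is at most 4^n.\<close>

lemma psi_double_le: "psi (2 * n) - psi n \<le> 2 * real n * ln 2"
proof -
  have "psi (2 * n) - psi n = (\<Sum>d\<in>{n<..2*n}. mangoldt d)"
    unfolding psi_def by (subst sum_diff[symmetric]) (auto intro: sum.cong)
  also have "\<dots> = (\<Sum>d=1..2*n. if n < d then mangoldt d else 0)"
    by (intro sum.mono_neutral_cong_left) auto
  also have "\<dots> \<le> (\<Sum>d=1..2*n. mangoldt d * (real (2 * n div d) - 2 * real (n div d)))"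
  proof (intro sum_mono)
    fix d assume d: "d \<in> {1..2*n}"
    have "2 * (n div d) \<le> 2 * n div d"
      using d by (simp add: less_eq_div_iff_mult_less_eq)
    moreover have "2 * n div d \<ge> 1" "n div d = 0" if "n < d"
      using that d by (simp_all add: div_greater_zero_iff Suc_le_eq)
    ultimately have "(if n < d then 1 else 0) \<le> real (2 * n div d) - 2 * real (n div d)"
      by auto
    then have "mangoldt d * (if n < d then 1 else 0) \<le> mangoldt d * (real (2 * n div d) - 2 * real (n div d))"
      by (intro mult_left_mono mangoldt_nonneg)
    then show "(if n < d then mangoldt d else 0) \<le> mangoldt d * (real (2 * n div d) - 2 * real (n div d))"
      by (simp split: if_splits)
  qed
  also have "\<dots> = ln (fact (2 * n)) - 2 * ln (fact n)"
    by (subst (1 2) ln_fact_eq_sum_mangoldt[of _ "2 * n"])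
       (auto simp: algebra_simps sum_subtractf sum_distrib_left)
  also have "\<dots> = ln (real ((2 * n) choose n))"
    by (simp add: binomial_fact ln_div ln_mult)
  also have "\<dots> \<le> ln (2 ^ (2 * n))"
  proof -
    have "((2 * n) choose n) \<le> 2 ^ (2 * n)"
      by (rule binomial_le_pow2)
    then have "real ((2 * n) choose n) \<le> 2 ^ (2 * n)"
      by (metis of_nat_le_iff of_nat_numeral of_nat_power)
    then show ?thesis
      by (simp add: zero_less_binomial)
  qed
  finally show ?thesis
    by (simp add: ln_realpow)
qed

lemma psi_power_2_le: "psi (2 ^ k) \<le> 2 ^ Suc k * ln 2"
proof (induction k)
  case 0
  have "psi 1 = 0" by (simp add: psi_def)
  then show ?case by simp
next
  case (Suc k)
  then show ?case
    using psi_double_le[of "2 ^ k"] by simp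
qed

text \<open>One factor 2 is the geometric sum over doublings, the other the rounding of n up to a
  power of 2; finally ln 2 < 1.\<close>

lemma psi_le: "psi n \<le> 4 * real n"
proof (cases "n = 0")
  case False
  obtain k where k: "2 ^ k \<le> n" "n < 2 ^ Suc k"
    using ex_power_ivl1[of 2 n] False by auto
  have "psi n \<le> psi (2 ^ Suc k)"
    using k by (intro psi_mono) auto
  also have "\<dots> \<le> 4 * real (2 ^ k) * ln 2"
    using psi_power_2_le[of "Suc k"] by simp
  also have "\<dots> \<le> 4 * real n * 1"
    using k(1) ln_2_less_1 by (intro mult_mono of_nat_mono mult_left_mono) auto
  finally show ?thesis by simp
qed (simp add: psi_def)

text \<open>Summation by parts; the boundary term A N * N^(-s) tends to 0 because A grows at most
  linearly and Re s > 1.\<close>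

lemma abel_summation_powr:
  fixes c :: "nat \<Rightarrow> complex"
  assumes c: "(\<lambda>n. c n * of_nat n powr (- s)) sums S"
    and A: "\<And>n. A n = (\<Sum>m\<le>n. c m)" and bound: "\<And>n. norm (A n) \<le> C * real n" and s: "Re s > 1"
  shows "(\<lambda>n. A n * (of_nat n powr (- s) - of_nat (Suc n) powr (- s))) sums S"
proof -
  have A_Suc: "A (Suc n) = A n + c (Suc n)" for n
    by (simp add: A)
  have A0: "A 0 = 0"
    using bound[of 0] by simp
  have partial: "(\<Sum>n<N. A n * (of_nat n powr (- s) - of_nat (Suc n) powr (- s))) =
          (\<Sum>n\<le>N. c n * of_nat n powr (- s)) - A N * of_nat N powr (- s)" for N
    by (induction N) (simp_all add: A_Suc A0 algebra_simps del: of_nat_Suc)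
  have "(\<lambda>n. A n * of_nat n powr (- s)) \<longlonglongrightarrow> 0"
  proof (rule Lim_null_comparison)
    have "(\<lambda>n. real n powr (1 - Re s)) \<longlonglongrightarrow> 0"
      using s by (intro tendsto_neg_powr filterlim_real_sequentially) auto
    then show "(\<lambda>n. C * real n powr (1 - Re s)) \<longlonglongrightarrow> 0"
      by (rule tendsto_mult_right_zero)
    have "norm (A n * of_nat n powr (- s)) \<le> C * real n powr (1 - Re s)" for n
    proof -
      have "norm (A n * of_nat n powr (- s)) \<le> C * real n * real n powr (- Re s)"
        using bound[of n] by (simp add: norm_mult norm_of_nat_powr mult_right_mono)
      also have "\<dots> = C * real n powr (1 - Re s)"
        using powr_mult_base[of "real n" "- Re s"] by simp
      finally show ?thesis .
    qed
    then show "\<forall>\<^sub>F n in sequentially. norm (A n * of_nat n powr (- s)) \<le> C * real n powr (1 - Re s)"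
      by simp
  qed
  moreover have "(\<lambda>N. \<Sum>n\<le>N. c n * of_nat n powr (- s)) \<longlonglongrightarrow> S"
    using c by (simp add: sums_def_le)
  ultimately have "(\<lambda>N. (\<Sum>n\<le>N. c n * of_nat n powr (- s)) - A N * of_nat N powr (- s)) \<longlonglongrightarrow> S - 0"
    by (intro tendsto_diff)
  then show ?thesis
    unfolding sums_def partial by simp
qed

text \<open>At s + 1 the remainder is of order n^(-2 - Re s); the linear growth of \<open>A\<close>
  costs one power and leaves a convergent series for Re s > 0.\<close>

lemma powr_remainder_series_holomorphic:
  fixes A :: "nat \<Rightarrow> complex"
  assumes A: "\<And>n. norm (A n) \<le> C * real n"
  shows "(\<lambda>s. \<Sum>n. A n * powr_remainder n (s + 1)) holomorphic_on {s. Re s > 0}"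
    and "\<And>s. Re s > 0 \<Longrightarrow> (\<lambda>n. A n * powr_remainder n (s + 1)) sums (\<Sum>n. A n * powr_remainder n (s + 1))"
proof -
  have C: "C \<ge> 0"
    using order_trans[OF norm_ge_zero A[of 1]] by simp
  have hol: "(\<lambda>s. A n * powr_remainder n (s + 1)) holomorphic_on {s. Re s > 0}" for n
    unfolding powr_remainder_def by (intro holomorphic_intros)
  have bound: "\<exists>h. summable h \<and> (\<forall>n>0. \<forall>s. x \<le> Re s \<longrightarrow> norm s \<le> R \<longrightarrow>
                 norm (A n * powr_remainder n (s + 1)) \<le> h n)" if x: "x > 0" for x R
  proof -
    have "norm (A n * powr_remainder n (s + 1)) \<le> C * ((R + 1) * R) * real n powr (- 1 - x)"
      if n: "n > 0" and s: "x \<le> Re s" "norm s \<le> R" for n s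
    proof -
      have "R \<ge> 0"
        using s norm_ge_zero order_trans by blast
      have "norm (s + 1) \<le> R + 1"
        using norm_triangle_ineq[of s 1] s by simp
      have "norm (powr_remainder n (s + 1)) \<le> norm (s + 1) * norm s * real n powr (- 1 - Re (s + 1))"
        using norm_powr_remainder_le[OF n, of "s + 1"] s x by simp
      also have "\<dots> \<le> (R + 1) * R * real n powr (- 2 - x)"
        using n s \<open>R \<ge> 0\<close> \<open>norm (s + 1) \<le> R + 1\<close> by (intro mult_mono powr_mono) auto
      finally have "norm (A n * powr_remainder n (s + 1)) \<le> (C * real n) * ((R + 1) * R * real n powr (- 2 - x))"
        unfolding norm_mult using A C by (intro mult_mono) auto
      also have "\<dots> = C * ((R + 1) * R) * (real n * real n powr (- 2 - x))"
        by simp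
      also have "real n * real n powr (- 2 - x) = real n powr (- 1 - x)"
        using powr_mult_base[of "real n" "- 2 - x"] by simp
      finally show ?thesis .
    qed
    moreover have "summable (\<lambda>n. C * ((R + 1) * R) * real n powr (- 1 - x))"
      by (intro summable_mult summable_powr_real x)
    ultimately show ?thesis
      by blast
  qed
  show "(\<lambda>s. \<Sum>n. A n * powr_remainder n (s + 1)) holomorphic_on {s. Re s > 0}"
    by (rule holomorphic_series_half_plane(1)[OF hol bound])
  show "\<And>s. Re s > 0 \<Longrightarrow> (\<lambda>n. A n * powr_remainder n (s + 1)) sums (\<Sum>n. A n * powr_remainder n (s + 1))"
    by (rule holomorphic_series_half_plane(2)[OF hol bound])
qed

text \<open>Writing the numerator of the pole as \<open>zeta_reg 1\<close> merges both polar parts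
  into a difference quotient, whose singularity at 1 is removable.\<close>

lemma mangoldt_minus_zeta:
  assumes s: "Re s > 1"
  shows "mangoldt_series s - zeta s = - ((zeta_reg s - zeta_reg 1) / (s - 1)) - deriv zeta_reg s / zeta_reg s"
proof -
  have "s \<noteq> 1" using s by auto
  then show ?thesis
    unfolding mangoldt_series_eq[OF s] zeta_reg_1
    by (simp add: zeta_reg_eq[OF s] diff_divide_distrib)
qed

text \<open>Summation by parts compares the Dirichlet series of \<open>(psi n - n) / n\<close> with \<open>mangoldt_series - zeta\<close>, in
  which the poles at \<open>1\<close> cancel; the discrepancy is again a series of the terms \<open>powr_remainder n\<close>.\<close>
lemma summable_psi_error: "summable (\<lambda>n. (psi n - real n) / real n ^ 2)"
proof -
  define A where "A = (\<lambda>n. complex_of_real (psi n - real n))"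
  define c where "c = (\<lambda>n. mangoldt n - (if n = 0 then 0 else 1) :: complex)"
  have A: "norm (A n) \<le> 4 * real n" for n
    using psi_le[of n] psi_nonneg[of n] unfolding A_def norm_of_real by linarith
  have Ac: "A n = (\<Sum>m\<le>n. c m)" for n
    by (induction n) (simp_all add: A_def psi_def c_def)
  define Q where "Q = (\<lambda>s. if s = 1 then deriv zeta_reg 1 else (zeta_reg s - zeta_reg 1) / (s - 1))"
  define H where "H = (\<lambda>s. \<Sum>n. A n * powr_remainder n (s + 1))"
  \<comment> \<open>From s n^(-1-s) = \<open>powr_remainder n (s + 1)\<close> + n^(-s) - (n+1)^(-s),
    weighted by \<open>A n\<close>, summed and divided by s.\<close>
  define G where "G = (\<lambda>s. (H s - Q s - deriv zeta_reg s / zeta_reg s) / s)"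
  define U where "U = {s. Re s > 0} \<inter> zeta_reg -` (- {0})"
  have open_half: "open {s :: complex. Re s > 0}"
    by (rule open_halfspace_Re_gt)
  have U: "open U"
    unfolding U_def
    by (intro continuous_open_preimage holomorphic_on_imp_continuous_on zeta_reg_holomorphic open_half) auto
  have sub: "U \<subseteq> {s. Re s > 0}"
    by (auto simp: U_def)
  have "Q holomorphic_on U"
    unfolding Q_def using pole_lemma_open[OF zeta_reg_holomorphic open_half] sub
    by (rule holomorphic_on_subset)
  moreover have "H holomorphic_on U"
    unfolding H_def using powr_remainder_series_holomorphic(1)[OF A] sub
    by (rule holomorphic_on_subset)
  moreover have "zeta_reg holomorphic_on U" "deriv zeta_reg holomorphic_on U"
    using holomorphic_on_subset[OF zeta_reg_holomorphic sub]
      holomorphic_on_subset[OF holomorphic_deriv[OF zeta_reg_holomorphic open_half] sub] by auto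
  ultimately have holG: "G holomorphic_on U"
    unfolding G_def by (intro holomorphic_intros U) (auto simp: U_def)
  have series: "(\<lambda>n. A n * of_nat n powr (- 1 - s)) sums G s" if s: "Re s > 1" for s
  proof -
    have [simp]: "s \<noteq> 0" "s \<noteq> 1"
      using s by auto
    have "(\<lambda>n. mangoldt n * of_nat n powr (- s) - of_nat n powr (- s)) sums (mangoldt_series s - zeta s)"
      by (intro sums_diff mangoldt_series_sums zeta_sums s)
    also have "(\<lambda>n. mangoldt n * of_nat n powr (- s) - of_nat n powr (- s)) = (\<lambda>n. c n * of_nat n powr (- s))"
      by (auto simp: c_def algebra_simps)
    finally have "(\<lambda>n. A n * (of_nat n powr (- s) - of_nat (Suc n) powr (- s))) sums (mangoldt_series s - zeta s)"
      by (rule abel_summation_powr[OF _ Ac A s])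
    moreover have "(\<lambda>n. A n * powr_remainder n (s + 1)) sums H s"
      unfolding H_def by (rule powr_remainder_series_holomorphic(2)[OF A]) (use s in auto)
    ultimately have "(\<lambda>n. (A n * powr_remainder n (s + 1) +
        A n * (of_nat n powr (- s) - of_nat (Suc n) powr (- s))) / s) sums ((H s + (mangoldt_series s - zeta s)) / s)"
      by (intro sums_divide sums_add)
    also have "(H s + (mangoldt_series s - zeta s)) / s = G s"
      unfolding mangoldt_minus_zeta[OF s] by (simp add: G_def Q_def)
    also have "(\<lambda>n. (A n * powr_remainder n (s + 1) +
        A n * (of_nat n powr (- s) - of_nat (Suc n) powr (- s))) / s) = (\<lambda>n. A n * of_nat n powr (- 1 - s))"
      by (simp add: powr_remainder_def algebra_simps del: of_nat_Suc)
    finally show ?thesis .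
  qed
  \<comment> \<open>The shift s = z + 1 moves the line Re s = 1 to the imaginary axis;
    \<open>U\<close> reaches across it because \<open>zeta_reg\<close> has no zero on Re s >=
    1.\<close>
  have "(\<lambda>n. (A n / of_nat n) / of_nat n) sums G (0 + 1)"
  proof (rule newman_tauberian[where C = 4 and U = "(\<lambda>z. z + 1) -` U"])
    show "norm (A n / of_nat n) \<le> 4" for n
      using A[of n] by (cases "n = 0") (auto simp: norm_divide field_simps)
    show "open ((\<lambda>z. z + 1) -` U)"
      by (intro open_vimage U continuous_intros)
    show "{z. Re z \<ge> 0} \<subseteq> (\<lambda>z. z + 1) -` U"
      using zeta_reg_nonzero by (auto simp: U_def)
    have "(G \<circ> (\<lambda>z. z + 1)) holomorphic_on (\<lambda>z. z + 1) -` U"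
      by (rule holomorphic_on_compose_gen[OF _ holG]) (auto intro!: holomorphic_intros)
    then show "(\<lambda>z. G (z + 1)) holomorphic_on (\<lambda>z. z + 1) -` U"
      by (simp add: o_def)
    fix z :: complex assume "Re z > 0"
    then have "(\<lambda>n. A n * of_nat n powr (- 1 - (z + 1))) sums G (z + 1)"
      by (intro series) auto
    moreover have "of_nat n powr (- 1 - (z + 1)) = of_nat n powr (- 1 - z) / (of_nat n :: complex)" for n
      using powr_diff[of "of_nat n :: complex" "- 1 - z" 1] by (cases "n = 0") simp_all
    ultimately show "(\<lambda>n. A n / of_nat n * of_nat n powr (- 1 - z)) sums G (z + 1)"
      by (simp add: field_simps)
  qed
  then have "summable (\<lambda>n. Re ((A n / of_nat n) / of_nat n))"
    using sums_Re sums_summable by blast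
  then show ?thesis
    by (simp add: A_def power2_eq_square)
qed

section \<open>From convergence of the error series to the asymptotics of \<open>psi\<close>\<close>

text \<open>If \<open>f n\<close> exceeds \<open>(1 + 2 e) n\<close>, then by monotonicity \<open>f m - m\<close> is at least \<open>e n\<close> for all \<open>m\<close> in
  \<open>[n, (1 + e) n]\<close>, and this block alone contributes a fixed positive amount to the series; the lower
  bound is symmetric.\<close>
lemma mono_asymp_of_summable:
  fixes f :: "nat \<Rightarrow> real"
  assumes mono: "mono f" and sm: "summable (\<lambda>n. (f n - real n) / real n ^ 2)"
  shows "(\<lambda>n. f n / real n) \<longlonglongrightarrow> 1"
proof -
  have upper: "\<forall>\<^sub>F n in sequentially. f n < (1 + 2 * e) * real n" if e: "e > 0" for e
  proof -
    \<comment> \<open>The block has at least e n / 2 terms, each at least e n / ((1 + e)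
      n)^2.\<close>
    define d where "d = e\<^sup>2 / (2 * (1 + e)\<^sup>2)"
    have "d > 0" using e by (simp add: d_def)
    then obtain N where N: "\<And>m n. m \<ge> N \<Longrightarrow> norm (\<Sum>k=m..<n. (f k - real k) / real k ^ 2) < d"
      using sm unfolding summable_Cauchy by blast
    \<comment> \<open>Then e n >= 2, and rounding e n down loses at most half of it.\<close>
    have "\<forall>\<^sub>F n in sequentially. real n \<ge> 2 / e"
      using filterlim_real_sequentially by (simp add: filterlim_at_top)
    with eventually_ge_at_top[of N] eventually_gt_at_top[of 0] show ?thesis
    proof eventually_elim
      case (elim n)
      show ?case
      proof (rule ccontr)
        assume "\<not> f n < (1 + 2 * e) * real n"
        then have fn: "f n \<ge> (1 + 2 * e) * real n" by simp
        define k where "k = nat \<lfloor>e * real n\<rfloor>"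
        have k: "real k \<le> e * real n" "real k \<ge> e * real n / 2"
        proof -
          have "real k = real_of_int \<lfloor>e * real n\<rfloor>"
            using e by (simp add: k_def)
          then show "real k \<le> e * real n" "real k \<ge> e * real n / 2"
            using elim e floor_correct[of "e * real n"] by (simp_all add: field_simps)
        qed
        have "d \<le> real k * (e * real n / ((1 + e) * real n)\<^sup>2)"
        proof -
          have "e\<^sup>2 / (2 * w\<^sup>2) = e * x / 2 * (e * x / (w * x)\<^sup>2)" if "w \<noteq> 0" "x \<noteq> 0" for w x :: real
            using that by (simp add: power2_eq_square field_simps)
          then have "d = e * real n / 2 * (e * real n / ((1 + e) * real n)\<^sup>2)"
            unfolding d_def using elim e by simp
          also have "\<dots> \<le> real k * (e * real n / ((1 + e) * real n)\<^sup>2)"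
            using k e by (intro mult_right_mono) auto
          finally show ?thesis .
        qed
        also have "\<dots> = (\<Sum>m=n..<n+k. e * real n / ((1 + e) * real n)\<^sup>2)"
          by simp
        also have "\<dots> \<le> (\<Sum>m=n..<n+k. (f m - real m) / real m ^ 2)"
        proof (intro sum_mono)
          fix m assume m: "m \<in> {n..<n+k}"
          have m': "real m \<le> (1 + e) * real n" "m > 0"
            using m k elim by (auto simp: algebra_simps)
          have "f n \<le> f m"
            using m mono by (auto simp: mono_def)
          then have "e * real n \<le> f m - real m"
            using fn m' by (simp add: algebra_simps)
          moreover have "0 \<le> e * real n"
            using e by simp
          ultimately show "e * real n / ((1 + e) * real n)\<^sup>2 \<le> (f m - real m) / real m ^ 2"
            using m' elim by (intro frac_le power_mono) auto
        qed
        also have "\<dots> < d"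
          using N[of n "n + k"] elim by (simp only: real_norm_def abs_less_iff)
        finally show False by simp
      qed
    qed
  qed
  have lower: "\<forall>\<^sub>F n in sequentially. f n > (1 - 2 * e) * real n" if e: "e > 0" "e < 1 / 2" for e
  proof -
    \<comment> \<open>Here the block lies below n, so the denominators are at most n^2. As e < 1/2
      it starts at n/2 or later, hence beyond N once n >= 2 N.\<close>
    define d where "d = e\<^sup>2 / 2"
    have "d > 0" using e by (simp add: d_def)
    then obtain N where N: "\<And>m n. m \<ge> N \<Longrightarrow> norm (\<Sum>k=m..<n. (f k - real k) / real k ^ 2) < d"
      using sm unfolding summable_Cauchy by blast
    have "\<forall>\<^sub>F n in sequentially. real n \<ge> 2 / e"
      using filterlim_real_sequentially by (simp add: filterlim_at_top)
    with eventually_ge_at_top[of "2 * N"] eventually_gt_at_top[of 0] show ?thesis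
    proof eventually_elim
      case (elim n)
      show ?case
      proof (rule ccontr)
        assume "\<not> f n > (1 - 2 * e) * real n"
        then have fn: "f n \<le> (1 - 2 * e) * real n" by simp
        define k where "k = nat \<lfloor>e * real n\<rfloor>"
        have k: "real k \<le> e * real n" "real k \<ge> e * real n / 2"
        proof -
          have "real k = real_of_int \<lfloor>e * real n\<rfloor>"
            using e by (simp add: k_def)
          then show "real k \<le> e * real n" "real k \<ge> e * real n / 2"
            using elim e floor_correct[of "e * real n"] by (simp_all add: field_simps)
        qed
        have "e * real n \<le> 1 / 2 * real n"
          using e by (intro mult_right_mono) auto
        then have kn: "2 * k \<le> n"
          using k by linarith
        have "d = e * real n / 2 * (e * real n / (real n)\<^sup>2)"
          using elim e by (simp add: d_def power2_eq_square field_simps)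
        also have "\<dots> \<le> real k * (e * real n / (real n)\<^sup>2)"
          using k e by (intro mult_right_mono) auto
        also have "\<dots> = (\<Sum>m=n-k..<n. e * real n / (real n)\<^sup>2)"
          using kn by simp
        also have "\<dots> \<le> (\<Sum>m=n-k..<n. - ((f m - real m) / real m ^ 2))"
        proof (intro sum_mono)
          fix m assume m: "m \<in> {n-k..<n}"
          have m': "real m \<ge> (1 - e) * real n" "m > 0" "m \<le> n"
            using m k kn elim by (auto simp: algebra_simps)
          have "f m \<le> f n"
            using m mono by (auto simp: mono_def)
          then have "e * real n \<le> real m - f m"
            using fn m' by (simp add: algebra_simps)
          moreover have "0 \<le> e * real n"
            using e by simp
          ultimately have "e * real n / (real n)\<^sup>2 \<le> (real m - f m) / real m ^ 2"
            using m' by (intro frac_le power_mono) auto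
          then show "e * real n / (real n)\<^sup>2 \<le> - ((f m - real m) / real m ^ 2)"
            by (simp add: minus_divide_left)
        qed
        also have "\<dots> = - (\<Sum>m=n-k..<n. (f m - real m) / real m ^ 2)"
          by (rule sum_negf)
        also have "\<dots> < d"
          using N[of "n - k" n] elim kn by (simp only: real_norm_def abs_less_iff)
        finally show False by simp
      qed
    qed
  qed
  show ?thesis
  proof (rule order_tendstoI)
    fix a :: real assume a: "a < 1"
    define e where "e = min ((1 - a) / 2) (1 / 4)"
    have "e \<le> (1 - a) / 2"
      unfolding e_def by (rule min.cobounded1)
    then have e: "a \<le> 1 - 2 * e"
      by (simp add: field_simps)
    have "e > 0" "e < 1 / 2"
      using a by (auto simp: e_def)
    note e = this e
    from lower[OF e(1,2)] eventually_gt_at_top[of 0] show "\<forall>\<^sub>F n in sequentially. a < f n / real n"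
    proof eventually_elim
      case (elim n)
      have "a * real n \<le> (1 - 2 * e) * real n"
        using e by (intro mult_right_mono) auto
      also have "\<dots> < f n"
        by (rule elim)
      finally show ?case using elim by (simp add: pos_less_divide_eq)
    qed
  next
    fix a :: real assume a: "a > 1"
    define e where "e = (a - 1) / 2"
    have e: "e > 0" "a = 1 + 2 * e"
      using a by (simp_all add: e_def field_simps)
    from upper[OF e(1)] eventually_gt_at_top[of 0] show "\<forall>\<^sub>F n in sequentially. f n / real n < a"
      by eventually_elim (simp add: pos_divide_less_eq e(2))
  qed
qed

lemma psi_asymp: "(\<lambda>n. psi n / real n) \<longlonglongrightarrow> 1"
  by (rule mono_asymp_of_summable) (auto simp: summable_psi_error mono_def psi_mono)

section \<open>From the Chebyshev function to counting primes\<close>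

text \<open>Group the prime powers up to n by their prime: there are at most ln n / ln p powers of
  p, each of weight ln p, so every prime contributes at most ln n.\<close>

lemma psi_le_card_primes:
  assumes n: "n > 0"
  shows "psi n \<le> real (card {p. prime p \<and> p \<le> n}) * ln (real n)"
proof -
  define D where "D = {d. d \<le> n \<and> primepow d}"
  define P where "P = {p. prime p \<and> p \<le> n}"
  have fin: "finite D" "finite P"
    by (auto simp: D_def P_def intro: finite_subset[of _ "{..n}"])
  have sub: "aprimedivisor ` D \<subseteq> P"
  proof
    fix p assume "p \<in> aprimedivisor ` D"
    then obtain d where d: "d \<le> n" "primepow d" "p = aprimedivisor d"
      by (auto simp: D_def)
    obtain q k where q: "prime q" "k > 0" "d = q ^ k"
      using d(2) by (auto simp: primepow_def)
    have "p = q"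
      using q d(3) by (simp add: aprimedivisor_prime_power)
    moreover have "q \<le> d"
      using q by (simp add: self_le_power prime_gt_0_nat Suc_leI)
    ultimately show "p \<in> P"
      using q d by (simp add: P_def)
  qed
  have fibre: "(\<Sum>d\<in>{d\<in>D. aprimedivisor d = p}. mangoldt d) \<le> ln (real n)" if p: "p \<in> P" for p
  proof -
    have p': "prime p" "p > 1" "p \<le> n"
      using p prime_gt_1_nat by (auto simp: P_def)
    define K where "K = nat \<lfloor>ln (real n) / ln (real p)\<rfloor>"
    have lnp: "ln (real p) > 0"
      using p' by simp
    have K: "real K * ln (real p) \<le> ln (real n)"
    proof -
      have "real K \<le> ln (real n) / ln (real p)"
        using n lnp by (simp add: K_def)
      then show ?thesis
        using lnp by (simp add: pos_le_divide_eq)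
    qed
    have subK: "{d\<in>D. aprimedivisor d = p} \<subseteq> (\<lambda>k. p ^ k) ` {1..K}"
    proof
      fix d assume "d \<in> {d\<in>D. aprimedivisor d = p}"
      then have d: "d \<le> n" "primepow d" "aprimedivisor d = p"
        by (auto simp: D_def)
      obtain q k where q: "prime q" "k > 0" "d = q ^ k"
        using d(2) by (auto simp: primepow_def)
      have dk: "d = p ^ k"
        using q d(3) by (simp add: aprimedivisor_prime_power)
      have "real k * ln (real p) = ln (real d)"
        using p' dk by (simp add: ln_realpow)
      also have "\<dots> \<le> ln (real n)"
        using d(1) dk p' by simp
      finally have "real k \<le> ln (real n) / ln (real p)"
        using lnp by (simp add: pos_le_divide_eq)
      then have "k \<le> K"
        by (simp add: K_def le_nat_iff le_floor_iff)
      then show "d \<in> (\<lambda>k. p ^ k) ` {1..K}"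
        using dk q(2) by auto
    qed
    have "(\<Sum>d\<in>{d\<in>D. aprimedivisor d = p}. mangoldt d) = (\<Sum>d\<in>{d\<in>D. aprimedivisor d = p}. ln (real p))"
      by (intro sum.cong refl) (auto simp: D_def mangoldt_def)
    also have "\<dots> \<le> real K * ln (real p)"
    proof -
      have "card {d\<in>D. aprimedivisor d = p} \<le> card {1..K}"
        using subK by (rule surj_card_le[rotated]) simp
      then show ?thesis
        using lnp by simp
    qed
    finally show ?thesis
      using K by simp
  qed
  have "psi n = (\<Sum>d\<in>D. mangoldt d)"
    unfolding psi_def D_def by (intro sum.mono_neutral_right) (auto simp: mangoldt_def)
  also have "\<dots> = (\<Sum>p\<in>P. \<Sum>d\<in>{d\<in>D. aprimedivisor d = p}. mangoldt d)"
    by (rule sum.group[symmetric, OF fin sub])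
  also have "\<dots> \<le> (\<Sum>p\<in>P. ln (real n))"
    by (intro sum_mono fibre)
  finally show ?thesis
    by (simp add: P_def)
qed

text \<open>Primes up to \<open>y\<close> are counted trivially; each prime above \<open>y\<close>
  adds more than ln y to \<open>psi n\<close>.\<close>

lemma card_primes_le:
  fixes x y :: real
  assumes y: "y > 1"
  shows "real (card {p. prime p \<and> p \<le> n}) \<le> y + psi n / ln y"
proof -
  define P where "P = {p. prime p \<and> p \<le> n}"
  define B where "B = {p\<in>P. real p > y}"
  have fin: "finite P" "finite B"
    by (auto simp: P_def B_def intro: finite_subset[of _ "{..n}"])
  have "P \<subseteq> {1..nat \<lfloor>y\<rfloor>} \<union> B"
    using prime_ge_1_nat y by (auto simp: P_def B_def le_nat_iff le_floor_iff not_less)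
  then have "card P \<le> card ({1..nat \<lfloor>y\<rfloor>} \<union> B)"
    using fin by (intro card_mono) auto
  also have "\<dots> \<le> nat \<lfloor>y\<rfloor> + card B"
    using card_Un_le[of "{1..nat \<lfloor>y\<rfloor>}" B] by simp
  finally have "real (card P) \<le> y + real (card B)"
    using y of_nat_floor[of y] by linarith
  moreover have "real (card B) * ln y \<le> psi n"
  proof -
    have "real (card B) * ln y = (\<Sum>p\<in>B. ln y)"
      by simp
    also have "\<dots> \<le> (\<Sum>p\<in>B. mangoldt p)"
      using y by (intro sum_mono) (auto simp: B_def P_def)
    also have "\<dots> \<le> psi n"
      unfolding psi_def by (intro sum_mono2) (auto simp: B_def P_def mangoldt_nonneg)
    finally show ?thesis .
  qed
  then have "real (card B) \<le> psi n / ln y"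
    using y by (simp add: pos_le_divide_eq)
  ultimately show ?thesis
    unfolding P_def[symmetric] by linarith
qed

text \<open>The integer \<open>\<lceil>x\<rceil> - 1\<close> is the largest one strictly below x,
  also when x is itself an integer.\<close>

lemma prime_count_eq_card: "prime_count x = card {p. prime p \<and> p \<le> nat (\<lceil>x\<rceil> - 1)}"
proof -
  have "real p < x \<longleftrightarrow> p \<le> nat (\<lceil>x\<rceil> - 1)" if "prime p" for p :: nat
  proof -
    have "real p < x \<longleftrightarrow> int p < \<lceil>x\<rceil>"
      by (simp add: less_ceiling_iff)
    then show ?thesis
      using prime_gt_0_nat[OF that] by (auto simp: le_nat_iff)
  qed
  then have "{p. prime p \<and> real p < x} = {p. prime p \<and> p \<le> nat (\<lceil>x\<rceil> - 1)}"
    by auto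
  then show ?thesis
    by (simp add: prime_count_def)
qed

lemma ln_over_powr_tendsto_0:
  fixes e :: real
  assumes e: "e > 0"
  shows "((\<lambda>x. ln x / x powr e) \<longlongrightarrow> 0) at_top"
proof -
  have "((\<lambda>x. ln (x powr e) / x powr e / e) \<longlongrightarrow> 0 / e) at_top"
    using e by (intro tendsto_divide tendsto_const filterlim_compose[OF ln_x_over_x_tendsto_0]
                  real_powr_at_top) auto
  moreover have "\<forall>\<^sub>F x in at_top. ln (x powr e) / x powr e / e = ln x / x powr e"
    using eventually_gt_at_top[of 0] by eventually_elim (use e in \<open>simp add: ln_powr\<close>)
  ultimately show ?thesis
    by (simp add: filterlim_cong[OF refl refl])
qed

theorem mainTheorem1:
  shows "((\<lambda>x::real. real (prime_count x) / (x / ln x)) \<longlongrightarrow> 1) at_top"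
proof -
  define N where "N = (\<lambda>x::real. nat (\<lceil>x\<rceil> - 1))"
  have N_bounds: "x - 1 \<le> real (N x)" "real (N x) < x" "N x > 0" if "x > 1" for x
    unfolding N_def using that ceiling_correct[of x] by linarith+
  have N_top: "filterlim N sequentially at_top"
    unfolding filterlim_at_top
  proof
    fix Z :: nat
    show "\<forall>\<^sub>F x in at_top. Z \<le> N x"
      using eventually_gt_at_top[of "1 + real Z"]
    proof eventually_elim
      case (elim x)
      then show ?case using N_bounds(1)[of x] by linarith
    qed
  qed
  have N_ratio: "((\<lambda>x. real (N x) / x) \<longlongrightarrow> 1) at_top"
  proof (rule tendsto_sandwich)
    have "((\<lambda>x::real. 1 - inverse x) \<longlongrightarrow> 1 - 0) at_top"
      by (intro tendsto_diff tendsto_const tendsto_inverse_0_at_top filterlim_ident)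
    then show "((\<lambda>x::real. 1 - inverse x) \<longlongrightarrow> 1) at_top" by simp
    show "\<forall>\<^sub>F x in at_top. 1 - inverse x \<le> real (N x) / x"
      using eventually_gt_at_top[of 1]
    proof eventually_elim
      case (elim x)
      have "1 - inverse x = (x - 1) / x"
        using elim by (simp add: field_simps)
      also have "\<dots> \<le> real (N x) / x"
        using elim by (intro divide_right_mono N_bounds) auto
      finally show ?case .
    qed
    show "\<forall>\<^sub>F x in at_top. real (N x) / x \<le> 1"
      using eventually_gt_at_top[of 1]
      by eventually_elim (use N_bounds(2) in \<open>simp add: field_simps less_imp_le\<close>)
  qed simp
  have "((\<lambda>x. psi (N x) / real (N x) * (real (N x) / x)) \<longlongrightarrow> 1 * 1) at_top"
    by (intro tendsto_mult N_ratio filterlim_compose[OF psi_asymp N_top])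
  moreover have "\<forall>\<^sub>F x in at_top. psi (N x) / real (N x) * (real (N x) / x) = psi (N x) / x"
    using eventually_gt_at_top[of 1] by eventually_elim (use N_bounds(3) in force)
  ultimately have psi: "((\<lambda>x. psi (N x) / x) \<longlongrightarrow> 1) at_top"
    by (simp add: Lim_transform_eventually)
  have count: "prime_count x = card {p. prime p \<and> p \<le> N x}" for x
    unfolding N_def by (rule prime_count_eq_card)
  show ?thesis
  proof (rule order_tendstoI)
    fix a :: real assume "a < 1"
    with psi have "\<forall>\<^sub>F x in at_top. a < psi (N x) / x"
      by (auto dest: order_tendstoD)
    with eventually_gt_at_top[of 1] show "\<forall>\<^sub>F x in at_top. a < real (prime_count x) / (x / ln x)"
    proof eventually_elim
      case (elim x)
      have "psi (N x) \<le> real (prime_count x) * ln (real (N x))"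
        unfolding count using N_bounds(3)[of x] elim by (intro psi_le_card_primes) auto
      also have "\<dots> \<le> real (prime_count x) * ln x"
        using N_bounds[of x] elim by (intro mult_left_mono) auto
      finally have "psi (N x) / x \<le> real (prime_count x) * ln x / x"
        using elim by (intro divide_right_mono) auto
      then show ?case
        using elim by simp
    qed
  next
    fix a :: real assume a: "a > 1"
    \<comment> \<open>This puts 1 - e halfway between 1/a and 1, whence 1 / (1 - e) < a.\<close>
    define e where "e = (1 - 1 / a) / 2"
    have e: "e > 0" "e < 1" "1 / (1 - e) < a"
      using a by (auto simp: e_def field_simps)
    have "((\<lambda>x. ln x / x powr e + psi (N x) / x / (1 - e)) \<longlongrightarrow> 0 + 1 / (1 - e)) at_top"
      by (intro tendsto_add tendsto_divide tendsto_const psi ln_over_powr_tendsto_0) (use e in auto)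
    then have "\<forall>\<^sub>F x in at_top. ln x / x powr e + psi (N x) / x / (1 - e) < a"
      by (rule order_tendstoD) (use e in auto)
    with eventually_gt_at_top[of 1] show "\<forall>\<^sub>F x in at_top. real (prime_count x) / (x / ln x) < a"
    proof eventually_elim
      case (elim x)
      have lnx: "ln x > 0"
        using elim by simp
      \<comment> \<open>The cut at x^(1-e) is negligible against x / ln x, while its logarithm falls
        short of ln x only by the factor 1 - e.\<close>
      have "real (prime_count x) \<le> x powr (1 - e) + psi (N x) / ln (x powr (1 - e))"
        unfolding count using elim e by (intro card_primes_le gr_one_powr) auto
      then have "real (prime_count x) * ln x / x \<le> (x powr (1 - e) + psi (N x) / ln (x powr (1 - e))) * ln x / x"
        using elim lnx by (intro divide_right_mono mult_right_mono) auto
      also have "\<dots> = x powr (1 - e) * ln x / x + psi (N x) / x / (1 - e)"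
        using elim lnx e by (simp add: ln_powr field_simps)
      also have "x powr (1 - e) * ln x / x = ln x / x powr e"
        using elim by (simp add: powr_diff)
      finally show ?case
        using elim by simp
    qed
  qed
qed

end
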